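(* Let $K:\mathbb{S}^2\times\mathbb{S}^2\to\mathbb{C}$ be a continuous kernel with $K(\xi,\zeta)=\overline{K(\zeta,\xi)}$ for all $\xi,\zeta\in\mathbb{S}^2$. Let $(F_\ell)_{\ell\ge 1}$ be an orthonormal basis of $L^2(\mathbb{S}^2)$ consisting of eigenfunctions of the Laplace-Beltrami operator, let $a_{\ell,\ell'}$ be the coefficients of the expansion $K(\xi,\zeta)=\sum_{\ell,\ell'=1}^\infty a_{\ell,\ell'}F_\ell(\xi)\overline{F_{\ell'}(\zeta)}$, and let $A:\ell^2\to\ell^2$ be the bounded linear operator $A(y)=\left(\sum_{\ell=1}^\infty a_{\ell,\ell'}y_\ell\right)_{\ell'=1}^\infty$. Then $K$ is positive definite on $\mathbb{S}^2$ if and only if $A$ is a positive operator on $\ell^2$.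
   Context: $\mathbb{S}^2=\{\xi\in\mathbb{R}^3:\xi_1^2+\xi_2^2+\xi_3^2=1\}$ with its surface measure; $L^2(\mathbb{S}^2)$ is the space of complex-valued square-integrable functions. $\ell^2$ is the Hilbert space of square-summable complex sequences indexed by $\ell\ge1$, with inner product $\langle x,y\rangle=\sum_{\ell\ge 1}\overline{x_\ell}y_\ell$. The coefficients are $a_{\ell,\ell'}=\int_{\mathbb{S}^2}\int_{\mathbb{S}^2}K(\xi,\zeta)\overline{F_\ell(\xi)}F_{\ell'}(\zeta)\,d\xi\,d\zeta$, the coefficients of $K\in L^2(\mathbb{S}^2\times\mathbb{S}^2)$ with respect to the orthonormal basis $F_\ell(\xi)\overline{F_{\ell'}(\zeta)}$. They satisfy $\sum_{\ell,\ell'}|a_{\ell,\ell'}|^2<\infty$, so $A$ is bounded on $\ell^2$. A linear continuous operator $P:H\to H$ on a complex Hilbert space $H$ is called positive if it is self-adjoint and $\langle P(x),x\rangle\ge 0$ for all $x\in H$. A Hermitian kernel $K$ is positive definite on $\mathbb{S}^2$ if for every finite set $\Xi\subset\mathbb{S}^2$ of distinct points the matrix $K_\Xi=(K(\xi,\zeta))_{\xi,\zeta\in\Xi}$ induces, by left multiplication, a positive operator on $\mathbb{C}^{|\Xi|}$ (i.e. $K_\Xi$ is Hermitian positive semi-definite). *)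

theory Defs
  imports "HOL-Analysis.Analysis"
begin

section \<open>The sphere and its surface measure\<close>

abbreviation S2 :: "(real ^ 3) set" where
  "S2 \<equiv> sphere 0 1"

definition spherical_coord :: "real \<times> real \<Rightarrow> real ^ 3" where
  "spherical_coord = (\<lambda>(\<theta>, \<phi>). vector [sin \<theta> * cos \<phi>, sin \<theta> * sin \<phi>, cos \<theta>])"

text \<open>The area element of the parametrisation by polar angle \<open>\<theta>\<close> and azimuth \<open>\<phi>\<close> is
  \<open>sin \<theta> d\<theta> d\<phi>\<close>. The underlying space of the measure is the sphere itself, so values of
  functions off the sphere are irrelevant.\<close>

definition sphere_measure :: "(real ^ 3) measure" where
  "sphere_measure =
     distr
       (density lborel (\<lambda>(\<theta>, \<phi>). ennreal (sin \<theta> * indicator ({0..pi} \<times> {0..2 * pi}) (\<theta>, \<phi>))))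
       (restrict_space borel S2) spherical_coord"


section \<open>Complex-valued square-integrable functions\<close>

definition L2 :: "'a measure \<Rightarrow> ('a \<Rightarrow> complex) set" where
  "L2 M = {f \<in> borel_measurable M. integrable M (\<lambda>x. (cmod (f x))\<^sup>2)}"

definition L2_inner :: "'a measure \<Rightarrow> ('a \<Rightarrow> complex) \<Rightarrow> ('a \<Rightarrow> complex) \<Rightarrow> complex" where
  "L2_inner M f g = (LINT x|M. cnj (f x) * g x)"

definition L2_norm :: "'a measure \<Rightarrow> ('a \<Rightarrow> complex) \<Rightarrow> real" where
  "L2_norm M f = sqrt (LINT x|M. (cmod (f x))\<^sup>2)"

text \<open>Orthonormal families indexed by the positive integers whose linear span is dense.\<close>

definition L2_orthonormal_basis :: "'a measure \<Rightarrow> (nat \<Rightarrow> 'a \<Rightarrow> complex) \<Rightarrow> bool" where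
  "L2_orthonormal_basis M F \<longleftrightarrow>
     (\<forall>l\<ge>1. F l \<in> L2 M) \<and>
     (\<forall>l\<ge>1. \<forall>m\<ge>1. L2_inner M (F l) (F m) = (if l = m then 1 else 0)) \<and>
     (\<forall>f\<in>L2 M. \<forall>\<epsilon>>0. \<exists>n c. L2_norm M (\<lambda>x. f x - (\<Sum>l=1..n. c l * F l x)) < \<epsilon>)"


section \<open>The Laplace-Beltrami operator\<close>

definition C2_on :: "'a::real_normed_vector set \<Rightarrow> ('a \<Rightarrow> 'b::real_normed_vector) \<Rightarrow> bool" where
  "C2_on S g \<longleftrightarrow>
     (\<exists>(g' :: 'a \<Rightarrow> 'a \<Rightarrow>\<^sub>L 'b) (g'' :: 'a \<Rightarrow> 'a \<Rightarrow>\<^sub>L ('a \<Rightarrow>\<^sub>L 'b)).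
        (\<forall>x\<in>S. (g has_derivative blinfun_apply (g' x)) (at x) \<and>
               (g' has_derivative blinfun_apply (g'' x)) (at x)) \<and>
        continuous_on S g'')"

definition laplacian :: "('a::euclidean_space \<Rightarrow> 'b::real_normed_vector) \<Rightarrow> 'a \<Rightarrow> 'b" where
  "laplacian g x =
     (\<Sum>b\<in>Basis. frechet_derivative (\<lambda>y. frechet_derivative g (at y) b) (at x) b)"

text \<open>A function on the sphere is extended to the punctured space so as to be constant on rays.
  It is of class \<open>C\<^sup>2\<close> on the sphere iff this extension is so off the origin, and its
  Laplace-Beltrami derivative is the restriction to the sphere of the Euclidean Laplacian of
  the extension.\<close>

definition radial_ext :: "(real ^ 3 \<Rightarrow> 'b) \<Rightarrow> real ^ 3 \<Rightarrow> 'b" where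
  "radial_ext f x = f (x /\<^sub>R norm x)"

definition laplace_beltrami :: "(real ^ 3 \<Rightarrow> complex) \<Rightarrow> real ^ 3 \<Rightarrow> complex" where
  "laplace_beltrami f = laplacian (radial_ext f)"

definition laplace_beltrami_eigenfunction :: "(real ^ 3 \<Rightarrow> complex) \<Rightarrow> bool" where
  "laplace_beltrami_eigenfunction f \<longleftrightarrow>
     C2_on (- {0}) (radial_ext f) \<and> (\<exists>\<xi>\<in>S2. f \<xi> \<noteq> 0) \<and>
     (\<exists>\<mu>. \<forall>\<xi>\<in>S2. laplace_beltrami f \<xi> = \<mu> * f \<xi>)"


section \<open>Square-summable families and positive operators\<close>

text \<open>Families over an index set \<open>I\<close>, represented by functions that vanish off \<open>I\<close>. This covers
  both the sequence space (\<open>I = {1..}\<close>) and, for finite \<open>I\<close>, the space of complex vectors with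
  coordinates indexed by \<open>I\<close>.\<close>

definition ell2 :: "'i set \<Rightarrow> ('i \<Rightarrow> complex) set" where
  "ell2 I = {x. (\<forall>i. i \<notin> I \<longrightarrow> x i = 0) \<and> (\<lambda>i. (cmod (x i))\<^sup>2) summable_on I}"

definition ell2_inner :: "'i set \<Rightarrow> ('i \<Rightarrow> complex) \<Rightarrow> ('i \<Rightarrow> complex) \<Rightarrow> complex" where
  "ell2_inner I x y = (\<Sum>\<^sub>\<infinity>i\<in>I. cnj (x i) * y i)"

definition ell2_norm :: "'i set \<Rightarrow> ('i \<Rightarrow> complex) \<Rightarrow> real" where
  "ell2_norm I x = sqrt (\<Sum>\<^sub>\<infinity>i\<in>I. (cmod (x i))\<^sup>2)"

definition ell2_bounded_linear :: "'i set \<Rightarrow> (('i \<Rightarrow> complex) \<Rightarrow> ('i \<Rightarrow> complex)) \<Rightarrow> bool" where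
  "ell2_bounded_linear I P \<longleftrightarrow>
     (\<forall>x\<in>ell2 I. P x \<in> ell2 I) \<and>
     (\<forall>x\<in>ell2 I. \<forall>y\<in>ell2 I. P (\<lambda>i. x i + y i) = (\<lambda>i. P x i + P y i)) \<and>
     (\<forall>c. \<forall>x\<in>ell2 I. P (\<lambda>i. c * x i) = (\<lambda>i. c * P x i)) \<and>
     (\<exists>B. \<forall>x\<in>ell2 I. ell2_norm I (P x) \<le> B * ell2_norm I x)"

definition positive_operator :: "'i set \<Rightarrow> (('i \<Rightarrow> complex) \<Rightarrow> ('i \<Rightarrow> complex)) \<Rightarrow> bool" where
  "positive_operator I P \<longleftrightarrow>
     ell2_bounded_linear I P \<and>
     (\<forall>x\<in>ell2 I. \<forall>y\<in>ell2 I. ell2_inner I (P x) y = ell2_inner I x (P y)) \<and>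
     (\<forall>x\<in>ell2 I. ell2_inner I (P x) x \<in> \<real>\<^sub>\<ge>\<^sub>0)"


section \<open>Kernels\<close>

definition kernel_matrix_operator ::
    "('a \<Rightarrow> 'a \<Rightarrow> complex) \<Rightarrow> 'a set \<Rightarrow> ('a \<Rightarrow> complex) \<Rightarrow> ('a \<Rightarrow> complex)" where
  "kernel_matrix_operator K X v = (\<lambda>\<xi>. if \<xi> \<in> X then (\<Sum>\<zeta>\<in>X. K \<xi> \<zeta> * v \<zeta>) else 0)"

definition positive_definite_on :: "'a set \<Rightarrow> ('a \<Rightarrow> 'a \<Rightarrow> complex) \<Rightarrow> bool" where
  "positive_definite_on S K \<longleftrightarrow>
     (\<forall>X. finite X \<and> X \<subseteq> S \<longrightarrow> positive_operator X (kernel_matrix_operator K X))"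

definition kernel_coeff ::
    "(real ^ 3 \<Rightarrow> real ^ 3 \<Rightarrow> complex) \<Rightarrow> (nat \<Rightarrow> real ^ 3 \<Rightarrow> complex) \<Rightarrow> nat \<Rightarrow> nat \<Rightarrow> complex" where
  "kernel_coeff K F l l' =
     (LINT \<xi>|sphere_measure. LINT \<zeta>|sphere_measure. K \<xi> \<zeta> * cnj (F l \<xi>) * F l' \<zeta>)"

text \<open>The sum runs over the first index of the coefficients, that is, the operator acts by the
  transpose of the matrix \<open>a\<close>.\<close>

definition coeff_operator :: "(nat \<Rightarrow> nat \<Rightarrow> complex) \<Rightarrow> (nat \<Rightarrow> complex) \<Rightarrow> (nat \<Rightarrow> complex)" where
  "coeff_operator a y = (\<lambda>l'. if l' \<ge> 1 then (\<Sum>\<^sub>\<infinity>l\<in>{1..}. a l l' * y l) else 0)"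

end

theory Submission
  imports Defs
begin

text \<open>Both kinds of positivity say that the Hermitian form
  \<open>q f = \<integral>\<integral> K x y * cnj (f x) * f y\<close> takes nonnegative values, but they test it on different objects.
  The finite sections of the coefficient operator are the values of \<open>q\<close> at finite linear
  combinations of the basis functions \<open>F l\<close>, whereas the quadratic forms of the kernel matrices are
  the values of \<open>q\<close> at finite combinations of point masses. Both classes of test objects approximate
  all square-integrable functions, or are approximated by them, in a way in which \<open>q\<close> is continuous.

  \<^item> The coefficients are square-summable by Bessel's inequality, and a Hermitian square-summable
    matrix defines a positive operator iff all its finite sections are nonnegative
    (\<open>positive_operator_iff_finite_sections\<close>). Applied to a finite index set, the same criterion
    rephrases positive definiteness of the kernel (\<open>positive_definite_on_iff\<close>).

  \<^item> Since \<open>K\<close> is uniformly continuous, the form of a sum of functions concentrated near points is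
    close to the quadratic form of the kernel matrix at the vector of their integrals
    (\<open>kernel_form_near_point_masses\<close>). If \<open>K\<close> is positive definite, an integrable function is cut
    into such pieces by a partition of unity, and \<open>q\<close> is nonnegative everywhere. Conversely,
    if \<open>q\<close> is nonnegative on square-integrable functions, normalised indicators of shrinking balls
    give the point masses; here it matters that the surface measure charges every ball.

  \<^item> From the span of the basis to all square-integrable functions one passes by density, because
    \<open>q\<close> is continuous for the integral norm (\<open>kernel_form_nonneg_of_dense_span\<close>).\<close>


section \<open>Operators of square-summable Hermitian matrices\<close>

definition matrix_operator :: "'i set \<Rightarrow> ('i \<Rightarrow> 'i \<Rightarrow> complex) \<Rightarrow> ('i \<Rightarrow> complex) \<Rightarrow> ('i \<Rightarrow> complex)" where
  "matrix_operator I b y = (\<lambda>i. if i \<in> I then (\<Sum>\<^sub>\<infinity>j\<in>I. b i j * y j) else 0)"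

abbreviation quadratic_form :: "('i \<Rightarrow> 'i \<Rightarrow> complex) \<Rightarrow> 'i set \<Rightarrow> ('i \<Rightarrow> complex) \<Rightarrow> complex" where
  "quadratic_form b J v \<equiv> (\<Sum>i\<in>J. \<Sum>j\<in>J. cnj (v i) * b i j * v j)"

text \<open>The nonnegative reals are closed. The factor \<open>C\<close> absorbs whatever constant an estimate carries,
  so that the limit arguments below need not rescale their \<open>\<epsilon>\<close>.\<close>

lemma nonneg_Reals_limitI:
  fixes z :: complex
  assumes "\<And>\<epsilon>. \<epsilon> > 0 \<Longrightarrow> \<exists>w\<in>\<real>\<^sub>\<ge>\<^sub>0. cmod (z - w) \<le> \<epsilon> * C"
  shows "z \<in> \<real>\<^sub>\<ge>\<^sub>0"
proof -
  have "z \<in> closure \<real>\<^sub>\<ge>\<^sub>0"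
    unfolding closure_approachable
  proof (intro allI impI)
    fix e :: real
    assume "e > 0"
    define \<epsilon> where "\<epsilon> = e / (\<bar>C\<bar> + 1)"
    have "\<epsilon> > 0"
      using \<open>e > 0\<close> by (simp add: \<epsilon>_def add_nonneg_pos)
    then obtain w where w: "w \<in> \<real>\<^sub>\<ge>\<^sub>0" "cmod (z - w) \<le> \<epsilon> * C"
      using assms by blast
    have "\<epsilon> * C < \<epsilon> * (\<bar>C\<bar> + 1)"
      using \<open>\<epsilon> > 0\<close> by (intro mult_strict_left_mono) auto
    also have "\<dots> = e"
      by (simp add: \<epsilon>_def add_nonneg_pos)
    finally show "\<exists>y\<in>\<real>\<^sub>\<ge>\<^sub>0. dist y z < e"
      using w by (force simp: dist_norm norm_minus_commute)
  qed
  then show ?thesis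
    by simp
qed

lemma ell2_pairing_summable:
  fixes x y :: "'i \<Rightarrow> complex"
  assumes "(\<lambda>i. (cmod (x i))\<^sup>2) summable_on I" "(\<lambda>i. (cmod (y i))\<^sup>2) summable_on I"
  shows "(\<lambda>i. cmod (x i * y i)) summable_on I" and "(\<lambda>i. x i * y i) summable_on I"
proof -
  show "(\<lambda>i. cmod (x i * y i)) summable_on I"
    by (rule abs_summable_product) (use assms in \<open>simp_all add: norm_mult power2_eq_square\<close>)
  then show "(\<lambda>i. x i * y i) summable_on I"
    by (rule abs_summable_summable)
qed

text \<open>Passing to the limit over finite partial sums reduces this to the Cauchy-Schwarz inequality for
  finite sums. It is what turns square-summability of the entries of a matrix into boundedness of
  the operator.\<close>

lemma ell2_Cauchy_Schwarz:
  fixes x y :: "'i \<Rightarrow> complex"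
  assumes x: "(\<lambda>i. (cmod (x i))\<^sup>2) summable_on I" and y: "(\<lambda>i. (cmod (y i))\<^sup>2) summable_on I"
  shows "(cmod (\<Sum>\<^sub>\<infinity>i\<in>I. x i * y i))\<^sup>2 \<le> (\<Sum>\<^sub>\<infinity>i\<in>I. (cmod (x i))\<^sup>2) * (\<Sum>\<^sub>\<infinity>i\<in>I. (cmod (y i))\<^sup>2)"
    (is "_ \<le> ?X * ?Y")
proof -
  have abs: "(\<lambda>i. cmod (x i * y i)) summable_on I"
    using assms by (rule ell2_pairing_summable)
  have nonneg: "?X * ?Y \<ge> 0"
    by (intro mult_nonneg_nonneg infsum_nonneg) auto
  have "sum (\<lambda>i. cmod (x i * y i)) J \<le> sqrt (?X * ?Y)" if J: "finite J" "J \<subseteq> I" for J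
  proof (rule real_le_rsqrt)
    have "(sum (\<lambda>i. cmod (x i * y i)) J)\<^sup>2 \<le> (\<Sum>i\<in>J. (cmod (x i))\<^sup>2) * (\<Sum>i\<in>J. (cmod (y i))\<^sup>2)"
      unfolding norm_mult by (rule Cauchy_Schwarz_ineq_sum)
    also have "\<dots> \<le> ?X * ?Y"
      using J x y by (intro mult_mono finite_sum_le_infsum sum_nonneg infsum_nonneg) auto
    finally show "(sum (\<lambda>i. cmod (x i * y i)) J)\<^sup>2 \<le> ?X * ?Y" .
  qed
  then have "(\<Sum>\<^sub>\<infinity>i\<in>I. cmod (x i * y i)) \<le> sqrt (?X * ?Y)"
    using abs by (intro infsum_le_finite_sums)
  then have "cmod (\<Sum>\<^sub>\<infinity>i\<in>I. x i * y i) \<le> sqrt (?X * ?Y)"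
    using norm_infsum_bound[OF abs] by linarith
  then have "(cmod (\<Sum>\<^sub>\<infinity>i\<in>I. x i * y i))\<^sup>2 \<le> (sqrt (?X * ?Y))\<^sup>2"
    by (rule power_mono) simp
  with nonneg show ?thesis
    by simp
qed

context
  fixes I :: "'i set" and b :: "'i \<Rightarrow> 'i \<Rightarrow> complex"
  assumes square_summable: "(\<lambda>(i, j). (cmod (b i j))\<^sup>2) summable_on I \<times> I"
begin

lemma row_square_summable: "i \<in> I \<Longrightarrow> (\<lambda>j. (cmod (b i j))\<^sup>2) summable_on I"
  by (rule summable_on_SigmaD1[OF square_summable])

lemma matrix_row_summable:
  "y \<in> ell2 I \<Longrightarrow> i \<in> I \<Longrightarrow> (\<lambda>j. b i j * y j) summable_on I"
  by (intro ell2_pairing_summable(2) row_square_summable) (auto simp: ell2_def)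

lemma matrix_operator_bounded:
  assumes y: "y \<in> ell2 I"
  shows "matrix_operator I b y \<in> ell2 I"
    and "ell2_norm I (matrix_operator I b y)
           \<le> sqrt (\<Sum>\<^sub>\<infinity>(i, j)\<in>I \<times> I. (cmod (b i j))\<^sup>2) * ell2_norm I y"
proof -
  let ?r = "\<lambda>i. \<Sum>\<^sub>\<infinity>j\<in>I. (cmod (b i j))\<^sup>2" and ?Y = "\<Sum>\<^sub>\<infinity>j\<in>I. (cmod (y j))\<^sup>2"
  have y2: "(\<lambda>j. (cmod (y j))\<^sup>2) summable_on I"
    using y by (simp add: ell2_def)
  have r: "?r summable_on I"
    by (rule summable_on_Sigma_banach[OF square_summable])
  have rY: "(\<lambda>i. ?r i * ?Y) summable_on I"
    by (rule summable_on_cmult_left[OF r])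
  have le: "(cmod (matrix_operator I b y i))\<^sup>2 \<le> ?r i * ?Y" if "i \<in> I" for i
    using ell2_Cauchy_Schwarz[OF row_square_summable[OF that] y2] that
    by (simp add: matrix_operator_def)
  have summable: "(\<lambda>i. (cmod (matrix_operator I b y i))\<^sup>2) summable_on I"
    using rY le by (rule summable_on_comparison_test) auto
  then show "matrix_operator I b y \<in> ell2 I"
    by (simp add: ell2_def matrix_operator_def)
  have "(\<Sum>\<^sub>\<infinity>i\<in>I. (cmod (matrix_operator I b y i))\<^sup>2) \<le> (\<Sum>\<^sub>\<infinity>i\<in>I. ?r i * ?Y)"
    using summable rY le by (rule infsum_mono)
  also have "\<dots> = (\<Sum>\<^sub>\<infinity>i\<in>I. ?r i) * ?Y"
    by (simp add: infsum_cmult_left')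
  also have "(\<Sum>\<^sub>\<infinity>i\<in>I. ?r i) = (\<Sum>\<^sub>\<infinity>(i, j)\<in>I \<times> I. (cmod (b i j))\<^sup>2)"
    using infsum_Sigma'_banach[OF square_summable] by simp
  finally show "ell2_norm I (matrix_operator I b y)
           \<le> sqrt (\<Sum>\<^sub>\<infinity>(i, j)\<in>I \<times> I. (cmod (b i j))\<^sup>2) * ell2_norm I y"
    by (simp add: ell2_norm_def flip: real_sqrt_mult)
qed

lemma matrix_operator_bounded_linear: "ell2_bounded_linear I (matrix_operator I b)"
  unfolding ell2_bounded_linear_def
proof (intro conjI ballI allI)
  show "matrix_operator I b (\<lambda>i. x i + y i) = (\<lambda>i. matrix_operator I b x i + matrix_operator I b y i)"
    if "x \<in> ell2 I" "y \<in> ell2 I" for x y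
    using that
    by (auto simp: matrix_operator_def ring_distribs fun_eq_iff infsum_add matrix_row_summable)
  show "matrix_operator I b (\<lambda>i. c * x i) = (\<lambda>i. c * matrix_operator I b x i)" for c x
    by (auto simp: matrix_operator_def fun_eq_iff mult.left_commute infsum_cmult_right')
  show "\<exists>B. \<forall>x\<in>ell2 I. ell2_norm I (matrix_operator I b x) \<le> B * ell2_norm I x"
    using matrix_operator_bounded(2) by blast
qed (rule matrix_operator_bounded)

lemma sesquilinear_summable:
  assumes x: "x \<in> ell2 I" and y: "y \<in> ell2 I"
  shows "(\<lambda>(i, j). cnj (x i) * b i j * y j) summable_on I \<times> I"
proof -
  have "(\<lambda>p. cmod (cnj (x (fst p)) * y (snd p)) ^ 2) summable_on I \<times> I"
  proof (rule summable_on_SigmaI)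
    show "((\<lambda>j. cmod (cnj (x (fst (i, j))) * y (snd (i, j))) ^ 2) has_sum
        ((cmod (x i))\<^sup>2 * (\<Sum>\<^sub>\<infinity>j\<in>I. (cmod (y j))\<^sup>2))) I" for i
      using y by (auto simp: norm_mult power_mult_distrib ell2_def intro!: has_sum_cmult_right)
    show "(\<lambda>i. (cmod (x i))\<^sup>2 * (\<Sum>\<^sub>\<infinity>j\<in>I. (cmod (y j))\<^sup>2)) summable_on I"
      using x by (auto simp: ell2_def intro!: summable_on_cmult_left)
  qed auto
  from ell2_pairing_summable(2)[OF this square_summable[unfolded case_prod_unfold]]
  show ?thesis
    by (simp add: case_prod_unfold mult_ac)
qed

lemma ell2_inner_matrix_operator:
  assumes x: "x \<in> ell2 I" and y: "y \<in> ell2 I"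
  shows "ell2_inner I x (matrix_operator I b y) = (\<Sum>\<^sub>\<infinity>(i, j)\<in>I \<times> I. cnj (x i) * b i j * y j)"
proof -
  have "ell2_inner I x (matrix_operator I b y) = (\<Sum>\<^sub>\<infinity>i\<in>I. \<Sum>\<^sub>\<infinity>j\<in>I. cnj (x i) * b i j * y j)"
    unfolding ell2_inner_def
    by (intro infsum_cong) (simp add: matrix_operator_def mult.assoc infsum_cmult_right')
  also have "\<dots> = (\<Sum>\<^sub>\<infinity>(i, j)\<in>I \<times> I. cnj (x i) * b i j * y j)"
    by (rule infsum_Sigma'_banach[OF sesquilinear_summable[OF x y]])
  finally show ?thesis .
qed

lemma matrix_operator_self_adjoint:
  assumes hermitian: "\<And>i j. i \<in> I \<Longrightarrow> j \<in> I \<Longrightarrow> b i j = cnj (b j i)"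
    and x: "x \<in> ell2 I" and y: "y \<in> ell2 I"
  shows "ell2_inner I (matrix_operator I b x) y = ell2_inner I x (matrix_operator I b y)"
proof -
  have cnj_b: "cnj (b i j) = b j i" if "i \<in> I" "j \<in> I" for i j
    using hermitian[OF that(2,1)] by simp
  have "ell2_inner I (matrix_operator I b x) y = cnj (ell2_inner I y (matrix_operator I b x))"
    by (simp only: ell2_inner_def infsum_cnj[symmetric] complex_cnj_mult complex_cnj_cnj mult.commute)
  also have "\<dots> = (\<Sum>\<^sub>\<infinity>(i, j)\<in>I \<times> I. y i * cnj (b i j) * cnj (x j))"
    by (simp only: ell2_inner_matrix_operator[OF y x] infsum_cnj[symmetric] case_prod_unfold complex_cnj_mult complex_cnj_cnj)
  also have "\<dots> = (\<Sum>\<^sub>\<infinity>(i, j)\<in>I \<times> I. cnj (x i) * b i j * y j)"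
    using cnj_b
    by (intro infsum_reindex_bij_witness[of _ prod.swap prod.swap]) (auto simp: mult_ac)
  finally show ?thesis
    by (simp add: ell2_inner_matrix_operator[OF x y])
qed

text \<open>One criterion serves both notions of positivity in the theorem: \<open>I\<close> may be a finite set of
  points of the sphere or the set of positive integers. A finite section is the form evaluated at
  a finitely supported vector; in the other direction the double series of the form is the limit
  of its partial sums over squares \<open>J \<times> J\<close>, and the nonnegative reals are closed.\<close>

lemma positive_operator_iff_finite_sections:
  assumes hermitian: "\<And>i j. i \<in> I \<Longrightarrow> j \<in> I \<Longrightarrow> b i j = cnj (b j i)"
  shows "positive_operator I (matrix_operator I b) \<longleftrightarrow>
    (\<forall>J v. finite J \<longrightarrow> J \<subseteq> I \<longrightarrow> quadratic_form b J v \<in> \<real>\<^sub>\<ge>\<^sub>0)"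
    (is "?pos \<longleftrightarrow> ?fin")
proof
  assume pos: ?pos
  show ?fin
  proof (intro allI impI)
    fix J and v :: "'i \<Rightarrow> complex"
    assume J: "finite J" "J \<subseteq> I"
    define x where "x = (\<lambda>i. if i \<in> J then v i else 0)"
    have "(\<lambda>i. (cmod (x i))\<^sup>2) summable_on I \<longleftrightarrow> (\<lambda>i. (cmod (x i))\<^sup>2) summable_on J"
      using J by (intro summable_on_cong_neutral) (auto simp: x_def)
    then have x: "x \<in> ell2 I"
      using J by (auto simp: ell2_def x_def)
    have "(\<Sum>\<^sub>\<infinity>(i, j)\<in>I \<times> I. cnj (x i) * b i j * x j) = (\<Sum>\<^sub>\<infinity>(i, j)\<in>J \<times> J. cnj (v i) * b i j * v j)"
      using J by (intro infsum_cong_neutral) (auto simp: x_def split: if_splits)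
    also have "\<dots> = quadratic_form b J v"
      using J by (simp add: sum.cartesian_product)
    finally have "ell2_inner I x (matrix_operator I b x) = quadratic_form b J v"
      by (simp add: ell2_inner_matrix_operator[OF x x])
    with pos x show "quadratic_form b J v \<in> \<real>\<^sub>\<ge>\<^sub>0"
      unfolding positive_operator_def by metis
  qed
next
  assume fin: ?fin
  have "ell2_inner I (matrix_operator I b x) x \<in> \<real>\<^sub>\<ge>\<^sub>0" if x: "x \<in> ell2 I" for x
  proof -
    have "(\<Sum>\<^sub>\<infinity>(i, j)\<in>I \<times> I. cnj (x i) * b i j * x j) \<in> \<real>\<^sub>\<ge>\<^sub>0"
    proof (rule nonneg_Reals_limitI[where C = 1])
      fix \<epsilon> :: real
      let ?f = "\<lambda>(i, j). cnj (x i) * b i j * x j"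
      assume "\<epsilon> > 0"
      have "(sum ?f \<longlongrightarrow> infsum ?f (I \<times> I)) (finite_subsets_at_top (I \<times> I))"
        using has_sum_infsum[OF sesquilinear_summable[OF x x]] by (simp add: has_sum_def)
      then have "\<forall>\<^sub>F G in finite_subsets_at_top (I \<times> I). dist (sum ?f G) (infsum ?f (I \<times> I)) < \<epsilon>"
        using \<open>\<epsilon> > 0\<close> by (rule tendstoD)
      then obtain G where G: "finite G" "G \<subseteq> I \<times> I" and
        close: "\<And>H. finite H \<Longrightarrow> G \<subseteq> H \<Longrightarrow> H \<subseteq> I \<times> I \<Longrightarrow> dist (sum ?f H) (infsum ?f (I \<times> I)) < \<epsilon>"
        unfolding eventually_finite_subsets_at_top by meson
      \<comment> \<open>The squares are cofinal among the finite subsets of the product: every \<open>G\<close> lies in one.\<close>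
      define J where "J = fst ` G \<union> snd ` G"
      have J: "finite J" "J \<subseteq> I" "G \<subseteq> J \<times> J"
        using G by (force simp: J_def)+
      then have "dist (sum ?f (J \<times> J)) (infsum ?f (I \<times> I)) < \<epsilon>"
        by (intro close) auto
      moreover have "sum ?f (J \<times> J) \<in> \<real>\<^sub>\<ge>\<^sub>0"
        using fin J unfolding sum.cartesian_product by blast
      ultimately show "\<exists>w\<in>\<real>\<^sub>\<ge>\<^sub>0. cmod (infsum ?f (I \<times> I) - w) \<le> \<epsilon> * 1"
        by (auto simp: dist_norm norm_minus_commute intro!: bexI[of _ "sum ?f (J \<times> J)"])
    qed
    moreover have "ell2_inner I (matrix_operator I b x) x = ell2_inner I x (matrix_operator I b x)"
      using hermitian x x by (rule matrix_operator_self_adjoint)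
    ultimately show ?thesis
      by (simp add: ell2_inner_matrix_operator[OF x x])
  qed
  then show ?pos
    unfolding positive_operator_def
    using matrix_operator_bounded_linear matrix_operator_self_adjoint[OF hermitian] by blast
qed

end

lemma positive_definite_on_iff:
  assumes hermitian: "\<And>x y. x \<in> S \<Longrightarrow> y \<in> S \<Longrightarrow> K x y = cnj (K y x)"
  shows "positive_definite_on S K \<longleftrightarrow>
    (\<forall>X v. finite X \<longrightarrow> X \<subseteq> S \<longrightarrow> quadratic_form K X v \<in> \<real>\<^sub>\<ge>\<^sub>0)"
proof -
  have "positive_operator X (kernel_matrix_operator K X) \<longleftrightarrow>
      (\<forall>J v. finite J \<longrightarrow> J \<subseteq> X \<longrightarrow> quadratic_form K J v \<in> \<real>\<^sub>\<ge>\<^sub>0)"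
    if X: "finite X" "X \<subseteq> S" for X
  proof -
    have "kernel_matrix_operator K X = matrix_operator X K"
      using X by (intro ext) (simp add: kernel_matrix_operator_def matrix_operator_def)
    moreover have "(\<lambda>(x, y). (cmod (K x y))\<^sup>2) summable_on X \<times> X"
      using X by (intro summable_on_finite finite_cartesian_product)
    then have "positive_operator X (matrix_operator X K) \<longleftrightarrow>
        (\<forall>J v. finite J \<longrightarrow> J \<subseteq> X \<longrightarrow> quadratic_form K J v \<in> \<real>\<^sub>\<ge>\<^sub>0)"
      by (rule positive_operator_iff_finite_sections) (use X in \<open>blast intro: hermitian\<close>)
    ultimately show ?thesis
      by (simp only:)
  qed
  then show ?thesis
    unfolding positive_definite_on_def by (meson finite_subset order_refl order_trans)
qed


section \<open>Square-integrable functions\<close>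

lemma mult_le_sum_squares:
  fixes a b :: real
  assumes "a \<ge> 0" "b \<ge> 0"
  shows "a * b \<le> a\<^sup>2 + b\<^sup>2"
proof -
  have "2 * (a * b) \<le> a\<^sup>2 + b\<^sup>2"
    using zero_le_power2[of "a - b"] by (simp add: power2_diff)
  moreover have "a * b \<ge> 0"
    using assms by simp
  ultimately show ?thesis
    by linarith
qed

lemma borel_measurable_cnj [measurable]:
  "f \<in> borel_measurable N \<Longrightarrow> (\<lambda>x. cnj (f x)) \<in> borel_measurable N"
  by (rule borel_measurable_continuous_on[of cnj]) (auto intro: continuous_intros)

lemma L2_mult_integrable:
  assumes "f \<in> L2 N" "g \<in> L2 N"
  shows "integrable N (\<lambda>x. cnj (f x) * g x)"
proof (rule Bochner_Integration.integrable_bound)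
  show "integrable N (\<lambda>x. (cmod (f x))\<^sup>2 + (cmod (g x))\<^sup>2)"
    using assms by (auto simp: L2_def)
  have "cmod (f x) * cmod (g x) \<le> (cmod (f x))\<^sup>2 + (cmod (g x))\<^sup>2" for x
    by (intro mult_le_sum_squares norm_ge_zero)
  then show "AE x in N. norm (cnj (f x) * g x) \<le> norm ((cmod (f x))\<^sup>2 + (cmod (g x))\<^sup>2)"
    by (simp add: norm_mult)
qed (use assms in \<open>auto simp: L2_def\<close>)

lemma L2_add:
  assumes "f \<in> L2 N" "g \<in> L2 N"
  shows "(\<lambda>x. f x + g x) \<in> L2 N"
proof -
  have "integrable N (\<lambda>x. (cmod (f x + g x))\<^sup>2)"
  proof (rule Bochner_Integration.integrable_bound)
    show "integrable N (\<lambda>x. 2 * (cmod (f x))\<^sup>2 + 2 * (cmod (g x))\<^sup>2)"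
      using assms by (auto simp: L2_def)
    have "(cmod (f x + g x))\<^sup>2 \<le> 2 * (cmod (f x))\<^sup>2 + 2 * (cmod (g x))\<^sup>2" for x
    proof -
      have "(cmod (f x + g x))\<^sup>2 \<le> (cmod (f x) + cmod (g x))\<^sup>2"
        by (intro power_mono norm_triangle_ineq) simp
      also have "\<dots> \<le> 2 * (cmod (f x))\<^sup>2 + 2 * (cmod (g x))\<^sup>2"
        using sum_squares_bound[of "cmod (f x)" "cmod (g x)"] by (simp add: power2_sum)
      finally show ?thesis .
    qed
    then show "AE x in N. norm ((cmod (f x + g x))\<^sup>2) \<le> norm (2 * (cmod (f x))\<^sup>2 + 2 * (cmod (g x))\<^sup>2)"
      by simp
  qed (use assms in \<open>auto simp: L2_def\<close>)
  with assms show ?thesis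
    by (auto simp: L2_def)
qed

lemma L2_cmult: "f \<in> L2 N \<Longrightarrow> (\<lambda>x. c * f x) \<in> L2 N"
  by (auto simp: L2_def norm_mult power_mult_distrib)

lemma L2_diff: "f \<in> L2 N \<Longrightarrow> g \<in> L2 N \<Longrightarrow> (\<lambda>x. f x - g x) \<in> L2 N"
  using L2_add[of f N "\<lambda>x. - 1 * g x"] L2_cmult[of g N "- 1"] by simp

lemma L2_sum: "(\<And>i. i \<in> J \<Longrightarrow> f i \<in> L2 N) \<Longrightarrow> (\<lambda>x. \<Sum>i\<in>J. f i x) \<in> L2 N"
proof (induction J rule: infinite_finite_induct)
  case (insert i J)
  then show ?case
    by (simp add: L2_add)
qed (auto simp: L2_def)

text \<open>Expand the squared norm of \<open>k - s\<close>, where \<open>s\<close> is the orthogonal projection of \<open>k\<close> onto the span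
  of the \<open>e i\<close>: the inner products of \<open>s\<close> with \<open>k\<close> and with itself are both the sum on the left.\<close>

lemma Bessel_inequality:
  assumes J: "finite J"
    and e: "\<And>i. i \<in> J \<Longrightarrow> e i \<in> L2 N"
    and orthonormal: "\<And>i j. i \<in> J \<Longrightarrow> j \<in> J \<Longrightarrow> L2_inner N (e i) (e j) = (if i = j then 1 else 0)"
    and k: "k \<in> L2 N"
  shows "(\<Sum>i\<in>J. (cmod (L2_inner N (e i) k))\<^sup>2) \<le> (LINT x|N. (cmod (k x))\<^sup>2)"
proof -
  define c where "c i = L2_inner N (e i) k" for i
  define s where "s x = (\<Sum>i\<in>J. c i * e i x)" for x
  have s: "s \<in> L2 N"
    unfolding s_def by (intro L2_sum L2_cmult e)
  have inner_s: "L2_inner N s h = (\<Sum>i\<in>J. cnj (c i) * L2_inner N (e i) h)" if "h \<in> L2 N" for h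
  proof -
    have "L2_inner N s h = (LINT x|N. (\<Sum>i\<in>J. cnj (c i) * (cnj (e i x) * h x)))"
      by (simp add: L2_inner_def s_def sum_distrib_right mult.assoc)
    also have "\<dots> = (\<Sum>i\<in>J. cnj (c i) * L2_inner N (e i) h)"
      using that e by (subst Bochner_Integration.integral_sum)
        (auto simp: L2_inner_def L2_mult_integrable)
    finally show ?thesis .
  qed
  have sk: "L2_inner N s k = of_real (\<Sum>i\<in>J. (cmod (c i))\<^sup>2)"
    by (simp only: inner_s[OF k] of_real_sum complex_norm_square c_def mult.commute)
  have "L2_inner N (e i) s = c i" if "i \<in> J" for i
  proof -
    have "L2_inner N (e i) s = (LINT x|N. (\<Sum>j\<in>J. c j * (cnj (e i x) * e j x)))"
      by (simp add: L2_inner_def s_def sum_distrib_left mult.left_commute)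
    also have "\<dots> = (\<Sum>j\<in>J. c j * L2_inner N (e i) (e j))"
      using that e by (subst Bochner_Integration.integral_sum)
        (auto simp: L2_inner_def L2_mult_integrable)
    also have "\<dots> = (\<Sum>j\<in>J. if i = j then c j else 0)"
      using that by (intro sum.cong) (auto simp: orthonormal)
    finally show ?thesis
      using that J by simp
  qed
  then have ss: "L2_inner N s s = L2_inner N s k"
    by (simp add: inner_s[OF s] inner_s[OF k] c_def)
  have ks: "L2_inner N k s = cnj (L2_inner N s k)"
    by (simp add: L2_inner_def mult.commute flip: Bochner_Integration.integral_cnj)
  have "complex_of_real (LINT x|N. (cmod (k x - s x))\<^sup>2) = (LINT x|N. cnj (k x - s x) * (k x - s x))"
    by (simp only: integral_complex_of_real[symmetric] complex_norm_square mult.commute)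
  also have "\<dots> = (LINT x|N. (cnj (k x) * k x - cnj (s x) * k x) - (cnj (k x) * s x - cnj (s x) * s x))"
    by (simp add: algebra_simps)
  also have "\<dots> = (L2_inner N k k - L2_inner N s k) - (L2_inner N k s - L2_inner N s s)"
    by (simp add: L2_inner_def L2_mult_integrable k s)
  also have "\<dots> = L2_inner N k k - of_real (\<Sum>i\<in>J. (cmod (c i))\<^sup>2)"
    by (simp add: ss ks sk)
  also have "L2_inner N k k = complex_of_real (LINT x|N. (cmod (k x))\<^sup>2)"
    by (simp only: L2_inner_def integral_complex_of_real[symmetric] complex_norm_square mult.commute)
  finally have "(LINT x|N. (cmod (k x - s x))\<^sup>2)
      = (LINT x|N. (cmod (k x))\<^sup>2) - (\<Sum>i\<in>J. (cmod (c i))\<^sup>2)"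
    by (simp only: of_real_diff[symmetric] of_real_eq_iff)
  moreover have "(LINT x|N. (cmod (k x - s x))\<^sup>2) \<ge> 0"
    by simp
  ultimately show ?thesis
    by (simp add: c_def)
qed

lemma integral_tensor:
  fixes f g :: "'a \<Rightarrow> 'c::{real_normed_field, banach, second_countable_topology}"
  assumes "sigma_finite_measure M" and f: "integrable M f" and g: "integrable M g"
  shows "integrable (M \<Otimes>\<^sub>M M) (\<lambda>(x, y). f x * g y)"
    and "(LINT (x, y)|(M \<Otimes>\<^sub>M M). f x * g y) = (LINT x|M. f x) * (LINT y|M. g y)"
proof -
  interpret sigma_finite_measure M by fact
  interpret pair_sigma_finite M M ..
  have [measurable]: "f \<in> borel_measurable M" "g \<in> borel_measurable M"
    using f g by auto
  show int: "integrable (M \<Otimes>\<^sub>M M) (\<lambda>(x, y). f x * g y)"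
    by (rule Fubini_integrable) (use f g in \<open>auto simp: norm_mult\<close>)
  show "(LINT (x, y)|(M \<Otimes>\<^sub>M M). f x * g y) = (LINT x|M. f x) * (LINT y|M. g y)"
    by (simp flip: integral_fst'[OF int])
qed

lemma (in finite_measure) L2_integrable:
  assumes "f \<in> L2 M"
  shows "integrable M f"
proof (rule Bochner_Integration.integrable_bound)
  show "integrable M (\<lambda>x. 1 + (cmod (f x))\<^sup>2)"
    using assms by (auto simp: L2_def)
  have "t \<le> 1 + t\<^sup>2" for t :: real
    using zero_le_power2[of "t - 1 / 2"] by (simp add: power2_diff power2_eq_square field_simps)
  then show "AE x in M. norm (f x) \<le> norm (1 + (cmod (f x))\<^sup>2)"
    by auto
qed (use assms in \<open>auto simp: L2_def\<close>)

text \<open>Integrating \<open>\<bar>f\<bar> \<le> t + \<bar>f\<bar>\<^sup>2 / t\<close> makes closeness in the square norm imply closeness in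
  the integral norm, in which the kernel forms below are continuous.\<close>

lemma (in finite_measure) L1_norm_le_of_L2_norm_less:
  assumes f: "f \<in> L2 M" and less: "L2_norm M f < t"
  shows "(LINT x|M. cmod (f x)) \<le> t * (1 + measure M (space M))"
proof -
  have t: "t > 0"
    using less by (rule le_less_trans[rotated]) (simp add: L2_norm_def)
  have int: "integrable M (\<lambda>x. (cmod (f x))\<^sup>2)"
    using f by (simp add: L2_def)
  have "(LINT x|M. (cmod (f x))\<^sup>2) \<le> t\<^sup>2"
    using less t by (intro sqrt_le_D) (simp add: L2_norm_def)
  have "(LINT x|M. cmod (f x)) \<le> (LINT x|M. t + (cmod (f x))\<^sup>2 / t)"
  proof (rule integral_mono)
    fix x
    have "cmod (f x) * t \<le> (cmod (f x))\<^sup>2 + t\<^sup>2"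
      using t by (intro mult_le_sum_squares) auto
    then show "cmod (f x) \<le> t + (cmod (f x))\<^sup>2 / t"
      using t by (simp add: field_simps power2_eq_square)
  qed (use L2_integrable[OF f] int in auto)
  also have "\<dots> = t * measure M (space M) + (LINT x|M. (cmod (f x))\<^sup>2) / t"
    using int by simp
  also have "(LINT x|M. (cmod (f x))\<^sup>2) / t \<le> t"
    using \<open>(LINT x|M. (cmod (f x))\<^sup>2) \<le> t\<^sup>2\<close> t by (simp add: field_simps power2_eq_square)
  finally show ?thesis
    by (simp add: algebra_simps)
qed


section \<open>Sesquilinear forms of bounded kernels\<close>

text \<open>This is the form whose values on a family of functions are the expansion coefficients of \<open>k\<close>; the
  order of the factors is that of \<^const>\<open>kernel_coeff\<close>.\<close>

definition kernel_form ::
    "'a measure \<Rightarrow> ('a \<Rightarrow> 'a \<Rightarrow> complex) \<Rightarrow> ('a \<Rightarrow> complex) \<Rightarrow> ('a \<Rightarrow> complex) \<Rightarrow> complex" where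
  "kernel_form M k f g = (LINT x|M. LINT y|M. k x y * cnj (f x) * g y)"

locale bounded_kernel = finite_measure M for M :: "'a measure" +
  fixes k :: "'a \<Rightarrow> 'a \<Rightarrow> complex" and C :: real
  assumes kernel_measurable: "(\<lambda>(x, y). k x y) \<in> borel_measurable (M \<Otimes>\<^sub>M M)"
    and kernel_bound: "\<And>x y. x \<in> space M \<Longrightarrow> y \<in> space M \<Longrightarrow> cmod (k x y) \<le> C"
begin

sublocale product: pair_sigma_finite M M ..

lemma kernel_form_integrable:
  assumes f: "integrable M f" and g: "integrable M g"
  shows "integrable (M \<Otimes>\<^sub>M M) (\<lambda>(x, y). k x y * cnj (f x) * g y)"
proof (rule Bochner_Integration.integrable_bound)
  show "integrable (M \<Otimes>\<^sub>M M) (\<lambda>p. C * (case p of (x, y) \<Rightarrow> cmod (f x) * cmod (g y)))"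
    using integral_tensor(1)[OF sigma_finite_measure_axioms integrable_norm[OF f] integrable_norm[OF g]]
    by simp
  have [measurable]: "f \<in> borel_measurable M" "g \<in> borel_measurable M"
    "(\<lambda>(x, y). k x y) \<in> borel_measurable (M \<Otimes>\<^sub>M M)"
    using f g kernel_measurable by auto
  show "(\<lambda>(x, y). k x y * cnj (f x) * g y) \<in> borel_measurable (M \<Otimes>\<^sub>M M)"
    by measurable
  have "cmod (k x y) * (cmod (f x) * cmod (g y)) \<le> \<bar>C\<bar> * (cmod (f x) * cmod (g y))"
    if "x \<in> space M" "y \<in> space M" for x y
    using kernel_bound[OF that] by (intro mult_right_mono) auto
  then show "AE p in M \<Otimes>\<^sub>M M. norm (case p of (x, y) \<Rightarrow> k x y * cnj (f x) * g y)
      \<le> norm (C * (case p of (x, y) \<Rightarrow> cmod (f x) * cmod (g y)))"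
    by (auto simp: space_pair_measure norm_mult abs_mult mult.assoc)
qed

lemma kernel_form_eq_product_integral:
  assumes "integrable M f" "integrable M g"
  shows "kernel_form M k f g = (LINT (x, y)|(M \<Otimes>\<^sub>M M). k x y * cnj (f x) * g y)"
  unfolding kernel_form_def using product.integral_fst'[OF kernel_form_integrable[OF assms]] by simp

lemma kernel_form_sum:
  assumes "\<And>i. i \<in> J \<Longrightarrow> integrable M (f i)" "\<And>j. j \<in> L \<Longrightarrow> integrable M (g j)"
  shows "kernel_form M k (\<lambda>x. \<Sum>i\<in>J. f i x) (\<lambda>x. \<Sum>j\<in>L. g j x)
    = (\<Sum>i\<in>J. \<Sum>j\<in>L. kernel_form M k (f i) (g j))"
proof -
  have "kernel_form M k (\<lambda>x. \<Sum>i\<in>J. f i x) (\<lambda>x. \<Sum>j\<in>L. g j x)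
    = (LINT (x, y)|(M \<Otimes>\<^sub>M M). k x y * cnj (\<Sum>i\<in>J. f i x) * (\<Sum>j\<in>L. g j y))"
    using assms by (intro kernel_form_eq_product_integral Bochner_Integration.integrable_sum)
  also have "\<dots> = (LINT p|(M \<Otimes>\<^sub>M M). (\<Sum>i\<in>J. \<Sum>j\<in>L. case p of (x, y) \<Rightarrow> k x y * cnj (f i x) * g j y))"
    by (intro Bochner_Integration.integral_cong refl)
      (simp add: case_prod_unfold sum_distrib_left sum_distrib_right sum.swap[of _ J L])
  also have "\<dots> = (\<Sum>i\<in>J. \<Sum>j\<in>L. kernel_form M k (f i) (g j))"
    using assms
    by (simp add: Bochner_Integration.integral_sum Bochner_Integration.integrable_sum
        kernel_form_integrable kernel_form_eq_product_integral cong: sum.cong)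
  finally show ?thesis .
qed

lemma kernel_form_cmult:
  "kernel_form M k (\<lambda>x. c * f x) (\<lambda>x. d * g x) = cnj c * kernel_form M k f g * d"
proof -
  have "kernel_form M k (\<lambda>x. c * f x) (\<lambda>x. d * g x)
      = (LINT x|M. cnj c * ((LINT y|M. k x y * cnj (f x) * g y) * d))"
    unfolding kernel_form_def
    by (intro Bochner_Integration.integral_cong refl)
      (simp add: mult_ac flip: integral_mult_right_zero integral_mult_left_zero)
  then show ?thesis
    by (simp add: kernel_form_def mult.assoc)
qed

text \<open>The key estimate: functions concentrated where the kernel is nearly constant see that constant
  only, so the form factors through their integrals. Closeness is required only on the supports,
  and the error is measured in integral norms, so that it remains bounded for bump functions that
  shrink to a point.\<close>

lemma kernel_form_near_constant:
  assumes f: "integrable M f" and g: "integrable M g"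
    and near: "\<And>x y. x \<in> space M \<Longrightarrow> y \<in> space M \<Longrightarrow> f x \<noteq> 0 \<Longrightarrow> g y \<noteq> 0 \<Longrightarrow> cmod (k x y - \<kappa>) \<le> \<epsilon>"
  shows "cmod (kernel_form M k f g - cnj (LINT x|M. f x) * \<kappa> * (LINT y|M. g y))
    \<le> \<epsilon> * ((LINT x|M. cmod (f x)) * (LINT y|M. cmod (g y)))"
proof -
  let ?T = "\<lambda>(x, y). cnj (f x) * g y" and ?N = "\<lambda>(x, y). cmod (f x) * cmod (g y)"
  have cf: "integrable M (\<lambda>x. cnj (f x))"
    using f by simp
  note T = integral_tensor[OF sigma_finite_measure_axioms cf g]
  note N = integral_tensor[OF sigma_finite_measure_axioms integrable_norm[OF f] integrable_norm[OF g]]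
  note kfg = kernel_form_integrable[OF f g]
  have T_integral: "(LINT p|(M \<Otimes>\<^sub>M M). ?T p) = cnj (LINT x|M. f x) * (LINT y|M. g y)"
    using T(2) by simp
  have "kernel_form M k f g - cnj (LINT x|M. f x) * \<kappa> * (LINT y|M. g y)
      = (LINT p|(M \<Otimes>\<^sub>M M). (case p of (x, y) \<Rightarrow> k x y * cnj (f x) * g y) - \<kappa> * ?T p)"
    using T(1) kfg by (simp add: kernel_form_eq_product_integral[OF f g] T_integral)
  also have "cmod \<dots> \<le> (LINT p|(M \<Otimes>\<^sub>M M). \<epsilon> * ?N p)"
  proof (rule order_trans[OF integral_norm_bound integral_mono])
    fix p assume "p \<in> space (M \<Otimes>\<^sub>M M)"
    then obtain x y where p: "p = (x, y)" "x \<in> space M" "y \<in> space M"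
      by (auto simp: space_pair_measure)
    have "cmod ((k x y - \<kappa>) * (cnj (f x) * g y)) \<le> \<epsilon> * (cmod (f x) * cmod (g y))"
    proof (cases "f x = 0 \<or> g y = 0")
      case False
      with near[OF p(2,3)] show ?thesis
        by (auto simp: norm_mult intro: mult_right_mono)
    qed auto
    then show "norm ((case p of (x, y) \<Rightarrow> k x y * cnj (f x) * g y) - \<kappa> * ?T p) \<le> \<epsilon> * ?N p"
      by (simp add: p algebra_simps)
  qed (use T N kfg in auto)
  also have "\<dots> = \<epsilon> * ((LINT x|M. cmod (f x)) * (LINT y|M. cmod (g y)))"
    using N by simp
  finally show ?thesis .
qed

lemma kernel_form_bound:
  assumes "integrable M f" "integrable M g"
  shows "cmod (kernel_form M k f g) \<le> C * ((LINT x|M. cmod (f x)) * (LINT y|M. cmod (g y)))"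
  using kernel_form_near_constant[OF assms, of 0 C] kernel_bound by simp

lemma kernel_form_hermitian:
  assumes hermitian: "\<And>x y. x \<in> space M \<Longrightarrow> y \<in> space M \<Longrightarrow> k x y = cnj (k y x)"
    and f: "integrable M f" and g: "integrable M g"
  shows "kernel_form M k f g = cnj (kernel_form M k g f)"
proof -
  have cnj_k: "cnj (k y x) = k x y" if "x \<in> space M" "y \<in> space M" for x y
    using hermitian[OF that] by simp
  have "cnj (kernel_form M k g f) = (LINT (x, y)|(M \<Otimes>\<^sub>M M). cnj (k x y) * g x * cnj (f y))"
    unfolding kernel_form_eq_product_integral[OF g f] Bochner_Integration.integral_cnj[symmetric]
    by (intro Bochner_Integration.integral_cong) auto
  also have "\<dots> = (LINT (y, x)|(M \<Otimes>\<^sub>M M). cnj (k x y) * g x * cnj (f y))"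
  proof -
    have "(\<lambda>p. cnj (case p of (x, y) \<Rightarrow> k x y * cnj (g x) * f y)) \<in> borel_measurable (M \<Otimes>\<^sub>M M)"
      using kernel_form_integrable[OF g f] by auto
    also have "(\<lambda>p. cnj (case p of (x, y) \<Rightarrow> k x y * cnj (g x) * f y))
        = (\<lambda>(x, y). cnj (k x y) * g x * cnj (f y))"
      by auto
    finally show ?thesis
      using product.integral_product_swap[of "\<lambda>(x, y). cnj (k x y) * g x * cnj (f y)"]
      by (simp add: case_prod_unfold)
  qed
  also have "\<dots> = (LINT (x, y)|(M \<Otimes>\<^sub>M M). k x y * cnj (f x) * g y)"
    by (intro Bochner_Integration.integral_cong)
      (auto simp: space_pair_measure cnj_k mult_ac)
  finally show ?thesis
    by (simp add: kernel_form_eq_product_integral[OF f g])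
qed

text \<open>The difference splits into the form of \<open>(h, f)\<close> and that of \<open>(g, h)\<close>, and the integral norm of
  \<open>g\<close> is at most that of \<open>f\<close> plus that of \<open>h\<close>.\<close>

lemma kernel_form_perturb:
  assumes f: "integrable M f" and g: "integrable M g"
  defines "h \<equiv> \<lambda>x. f x - g x"
  shows "cmod (kernel_form M k f f - kernel_form M k g g)
    \<le> C * ((LINT x|M. cmod (h x)) * (2 * (LINT x|M. cmod (f x)) + (LINT x|M. cmod (h x))))"
proof -
  let ?n = "\<lambda>f. LINT x|M. cmod (f x)"
  have h: "integrable M h"
    using f g by (simp add: h_def)
  have "kernel_form M k f f = kernel_form M k h f + kernel_form M k g f"
    using kernel_form_sum[of "{True, False}" "\<lambda>i. if i then h else g" "{True}" "\<lambda>_. f"] f g h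
    by (simp add: h_def)
  moreover have "kernel_form M k g f = kernel_form M k g h + kernel_form M k g g"
    using kernel_form_sum[of "{True}" "\<lambda>_. g" "{True, False}" "\<lambda>i. if i then h else g"] f g h
    by (simp add: h_def)
  ultimately have "cmod (kernel_form M k f f - kernel_form M k g g)
      \<le> cmod (kernel_form M k h f) + cmod (kernel_form M k g h)"
    by (simp add: norm_triangle_ineq)
  also have "\<dots> \<le> C * (?n h * ?n f) + C * (?n g * ?n h)"
    by (intro add_mono kernel_form_bound f g h)
  also have "\<dots> = C * (?n h * (?n f + ?n g))"
    by (simp add: algebra_simps)
  also have "\<dots> \<le> C * (?n h * (?n f + (?n f + ?n h)))"
  \<comment> \<open>On a nonempty space the bound of the kernel is nonnegative; on the empty one all integrals vanish.\<close>
  proof (cases "space M = {}")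
    case True
    then show ?thesis
      by (simp add: Bochner_Integration.integral_empty)
  next
    case False
    then obtain z where "z \<in> space M"
      by blast
    then have "C \<ge> 0"
      using kernel_bound[of z z] norm_ge_zero order_trans by blast
    moreover have "?n g \<le> (LINT x|M. cmod (f x) + cmod (h x))"
    proof (rule integral_mono)
      show "cmod (g x) \<le> cmod (f x) + cmod (h x)" for x
        using norm_triangle_sub[of "g x" "f x"] by (simp add: h_def norm_minus_commute)
    qed (use f g h in auto)
    ultimately show ?thesis
      using f h by (intro mult_left_mono add_left_mono) auto
  qed
  finally show ?thesis
    by (simp add: algebra_simps)
qed

text \<open>The tensor products \<open>e\<close> of the \<open>F l\<close> with the conjugates of the \<open>F m\<close> are orthonormal for the
  product measure, and the coefficients are the inner products of the kernel with them, so that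
  Bessel's inequality bounds all partial sums by the squared norm of the kernel.\<close>

lemma kernel_coefficients_square_summable:
  assumes F: "\<And>l. l \<in> I \<Longrightarrow> F l \<in> L2 M"
    and orthonormal: "\<And>l m. l \<in> I \<Longrightarrow> m \<in> I \<Longrightarrow> L2_inner M (F l) (F m) = (if l = m then 1 else 0)"
  shows "(\<lambda>(l, m). (cmod (kernel_form M k (F l) (F m)))\<^sup>2) summable_on I \<times> I"
proof (rule nonneg_bdd_above_summable_on)
  define e where "e = (\<lambda>(l, m) (x, y). F l x * cnj (F m y))"
  let ?k = "\<lambda>(x, y). k x y"
  have Fm [measurable]: "F l \<in> borel_measurable M" if "l \<in> I" for l
    using F[OF that] by (simp add: L2_def)
  have e: "e p \<in> L2 (M \<Otimes>\<^sub>M M)" if "p \<in> I \<times> I" for p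
  proof -
    obtain l m where p: "p = (l, m)" "l \<in> I" "m \<in> I"
      using \<open>p \<in> I \<times> I\<close> by auto
    note [measurable] = Fm[OF p(2)] Fm[OF p(3)]
    have "integrable M (\<lambda>x. (cmod (F l x))\<^sup>2)" "integrable M (\<lambda>x. (cmod (F m x))\<^sup>2)"
      using F p by (auto simp: L2_def)
    from integral_tensor(1)[OF sigma_finite_measure_axioms this]
    show ?thesis
      by (simp add: L2_def e_def p case_prod_unfold norm_mult power_mult_distrib)
  qed
  have e_inner: "L2_inner (M \<Otimes>\<^sub>M M) (e p) (e q) = (if p = q then 1 else 0)"
    if "p \<in> I \<times> I" "q \<in> I \<times> I" for p q
  proof -
    obtain l m where p: "p = (l, m)" "l \<in> I" "m \<in> I"
      using \<open>p \<in> I \<times> I\<close> by auto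
    obtain l' m' where q: "q = (l', m')" "l' \<in> I" "m' \<in> I"
      using \<open>q \<in> I \<times> I\<close> by auto
    note pq = p q
    have "L2_inner (M \<Otimes>\<^sub>M M) (e p) (e q)
        = (LINT (x, y)|(M \<Otimes>\<^sub>M M). (cnj (F l x) * F l' x) * (cnj (F m' y) * F m y))"
      by (simp add: L2_inner_def e_def pq case_prod_unfold mult_ac)
    also have "\<dots> = L2_inner M (F l) (F l') * L2_inner M (F m') (F m)"
      unfolding L2_inner_def
      by (intro integral_tensor sigma_finite_measure_axioms L2_mult_integrable F pq)
    finally show ?thesis
      using pq by (simp add: orthonormal)
  qed
  have "integrable (M \<Otimes>\<^sub>M M) (\<lambda>p. (cmod (?k p))\<^sup>2)"
  proof (rule Bochner_Integration.integrable_bound)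
    show "integrable (M \<Otimes>\<^sub>M M) (\<lambda>_. C\<^sup>2)"
      using integral_tensor(1)[OF sigma_finite_measure_axioms, of "\<lambda>_. C" "\<lambda>_. C"]
      by (simp only: power2_eq_square case_prod_unfold) auto
    have "(cmod (k x y))\<^sup>2 \<le> C\<^sup>2" if "x \<in> space M" "y \<in> space M" for x y
      using kernel_bound[OF that] by (intro power_mono) auto
    then show "AE p in M \<Otimes>\<^sub>M M. norm ((cmod (?k p))\<^sup>2) \<le> norm (C\<^sup>2)"
      by (auto simp: space_pair_measure)
  qed (use kernel_measurable in measurable)
  then have k: "?k \<in> L2 (M \<Otimes>\<^sub>M M)"
    using kernel_measurable by (simp add: L2_def)
  have coeff: "L2_inner (M \<Otimes>\<^sub>M M) (e p) ?k = (case p of (l, m) \<Rightarrow> kernel_form M k (F l) (F m))"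
    if "p \<in> I \<times> I" for p
    using that F
    by (auto simp: L2_inner_def e_def kernel_form_eq_product_integral L2_integrable case_prod_unfold mult_ac)
  show "bdd_above (sum (\<lambda>(l, m). (cmod (kernel_form M k (F l) (F m)))\<^sup>2) ` {P. P \<subseteq> I \<times> I \<and> finite P})"
  proof (rule bdd_aboveI2)
    fix P assume "P \<in> {P. P \<subseteq> I \<times> I \<and> finite P}"
    then have P: "P \<subseteq> I \<times> I" "finite P"
      by auto
    have "(\<Sum>(l, m)\<in>P. (cmod (kernel_form M k (F l) (F m)))\<^sup>2)
        = (\<Sum>p\<in>P. (cmod (L2_inner (M \<Otimes>\<^sub>M M) (e p) ?k))\<^sup>2)"
      using P by (intro sum.cong) (auto simp: coeff)
    also have "\<dots> \<le> (LINT p|(M \<Otimes>\<^sub>M M). (cmod (?k p))\<^sup>2)"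
    proof (rule Bessel_inequality)
      show "e p \<in> L2 (M \<Otimes>\<^sub>M M)" if "p \<in> P" for p
        using that P e by blast
      show "L2_inner (M \<Otimes>\<^sub>M M) (e p) (e q) = (if p = q then 1 else 0)" if "p \<in> P" "q \<in> P" for p q
        using that P e_inner by blast
    qed (use P k in auto)
    finally show "(\<Sum>(l, m)\<in>P. (cmod (kernel_form M k (F l) (F m)))\<^sup>2)
        \<le> (LINT p|(M \<Otimes>\<^sub>M M). (cmod (?k p))\<^sup>2)" .
  qed
qed auto

end


section \<open>Continuous kernels on compact spaces\<close>

text \<open>The two notions of positivity are compared for a finite Borel measure on a compact metric space;
  the sphere with its surface measure is the instance of interest.\<close>

locale continuous_kernel = finite_measure M
  for M :: "'a::{metric_space, second_countable_topology} measure" +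
  fixes S :: "'a set" and K :: "'a \<Rightarrow> 'a \<Rightarrow> complex"
  assumes space_eq: "space M = S"
    and sets_eq: "sets M = sets (restrict_space borel S)"
    and compact_S: "compact S"
    and continuous_K: "continuous_on (S \<times> S) (\<lambda>(x, y). K x y)"
begin

lemma continuous_imp_borel_measurable:
  fixes f :: "'a \<Rightarrow> 'b::topological_space"
  assumes "continuous_on S f"
  shows "f \<in> borel_measurable M"
  using borel_measurable_continuous_on_restrict[OF assms]
  by (simp add: measurable_cong_sets[OF sets_eq refl])

text \<open>Extending the kernel by zero off \<open>S \<times> S\<close> gives a Borel function on the whole product space; the
  product sigma-algebra is the Borel one because the topology is second countable.\<close>

lemma exists_bounded_kernel: "\<exists>C. bounded_kernel M K C"
proof -
  let ?K = "\<lambda>(x, y). K x y"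
  have "compact (?K ` (S \<times> S))"
    by (intro compact_continuous_image continuous_K compact_Times compact_S)
  then obtain C where C: "\<And>p. p \<in> S \<times> S \<Longrightarrow> cmod (?K p) \<le> C"
    unfolding bounded_iff using compact_imp_bounded bounded_iff by (metis imageI)
  have "closed (S \<times> S)"
    using compact_S by (intro closed_Times compact_imp_closed)
  then have "(\<lambda>p. indicator (S \<times> S) p *\<^sub>R ?K p) \<in> borel_measurable borel"
    using continuous_K by (intro borel_measurable_continuous_on_indicator borel_closed)
  moreover have "(\<lambda>x. x) \<in> measurable M borel"
    by (intro continuous_imp_borel_measurable continuous_on_id)
  then have "(\<lambda>p. (fst p, snd p)) \<in> measurable (M \<Otimes>\<^sub>M M) (borel \<Otimes>\<^sub>M borel)"
    by (intro measurable_Pair measurable_compose[OF measurable_fst] measurable_compose[OF measurable_snd])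
  then have "(\<lambda>p. p) \<in> measurable (M \<Otimes>\<^sub>M M) borel"
    by (simp add: borel_prod)
  ultimately have "(\<lambda>p. indicator (S \<times> S) p *\<^sub>R ?K p) \<in> borel_measurable (M \<Otimes>\<^sub>M M)"
    by (rule measurable_compose[rotated])
  moreover have "indicator (S \<times> S) p *\<^sub>R ?K p = ?K p" if "p \<in> space (M \<Otimes>\<^sub>M M)" for p
    using that by (simp add: space_pair_measure space_eq)
  ultimately have "?K \<in> borel_measurable (M \<Otimes>\<^sub>M M)"
    by (simp cong: measurable_cong)
  with C show ?thesis
    by (auto simp: bounded_kernel_def bounded_kernel_axioms_def space_eq finite_measure_axioms)
qed

text \<open>Such families stand in for measures supported on the finite set \<open>X\<close>: the mass of \<open>f x\<close> lies close
  to the point \<open>x\<close>.\<close>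

definition localized_family :: "real \<Rightarrow> 'a set \<Rightarrow> ('a \<Rightarrow> 'a \<Rightarrow> complex) \<Rightarrow> bool" where
  "localized_family \<delta> X f \<longleftrightarrow> finite X \<and> X \<subseteq> S \<and> (\<forall>x\<in>X. integrable M (f x)) \<and>
     (\<forall>x\<in>X. \<forall>y\<in>S. f x y \<noteq> 0 \<longrightarrow> dist y x < \<delta>)"

text \<open>The bridge between integrals and point values, used in both directions. By uniform continuity,
  the kernel is within \<open>\<epsilon>\<close> of \<open>K x y\<close> on the product of the supports of \<open>f x\<close> and \<open>f y\<close>, and the
  estimate for nearly constant kernels applies to each pair.\<close>

lemma kernel_form_near_point_masses:
  assumes "\<epsilon> > 0"
  shows "\<exists>\<delta>>0. \<forall>X f. localized_family \<delta> X f \<longrightarrow>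
      cmod (kernel_form M K (\<lambda>y. \<Sum>x\<in>X. f x y) (\<lambda>y. \<Sum>x\<in>X. f x y)
        - quadratic_form K X (\<lambda>x. LINT z|M. f x z))
      \<le> \<epsilon> * (\<Sum>x\<in>X. LINT z|M. cmod (f x z))\<^sup>2"
proof -
  obtain C where "bounded_kernel M K C"
    using exists_bounded_kernel by blast
  then interpret bounded_kernel M K C .
  have "uniformly_continuous_on (S \<times> S) (\<lambda>(x, y). K x y)"
    by (intro compact_uniformly_continuous continuous_K compact_Times compact_S)
  then obtain d where "d > 0" and d: "\<And>p q. p \<in> S \<times> S \<Longrightarrow> q \<in> S \<times> S \<Longrightarrow> dist q p < d
      \<Longrightarrow> dist (case q of (x, y) \<Rightarrow> K x y) (case p of (x, y) \<Rightarrow> K x y) < \<epsilon>"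
    using assms unfolding uniformly_continuous_on_def by metis
  have near: "cmod (K x' y' - K x y) \<le> \<epsilon>"
    if "x \<in> S" "y \<in> S" "x' \<in> S" "y' \<in> S" "dist x' x < d / 2" "dist y' y < d / 2" for x y x' y'
  proof -
    have "dist (x', y') (x, y) \<le> dist x' x + dist y' y"
      by (simp add: dist_Pair_Pair sqrt_sum_squares_le_sum)
    also have "\<dots> < d"
      using that by linarith
    finally show ?thesis
      using d[of "(x, y)" "(x', y')"] that by (simp add: dist_norm)
  qed
  show ?thesis
  proof (intro exI[of _ "d / 2"] conjI allI impI)
    fix X f
    assume "localized_family (d / 2) X f"
    then have X: "finite X" "X \<subseteq> S" and f: "\<And>x. x \<in> X \<Longrightarrow> integrable M (f x)"
      and supp: "\<And>x y. \<lbrakk>x \<in> X; y \<in> S; f x y \<noteq> 0\<rbrakk> \<Longrightarrow> dist y x < d / 2"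
      by (auto simp: localized_family_def)
    let ?n = "\<lambda>x. LINT z|M. cmod (f x z)"
    have "cmod (kernel_form M K (\<lambda>y. \<Sum>x\<in>X. f x y) (\<lambda>y. \<Sum>x\<in>X. f x y)
        - quadratic_form K X (\<lambda>x. LINT z|M. f x z))
      = cmod (\<Sum>x\<in>X. \<Sum>y\<in>X. kernel_form M K (f x) (f y)
          - cnj (LINT z|M. f x z) * K x y * (LINT z|M. f y z))"
      by (simp add: kernel_form_sum f sum_subtractf)
    also have "\<dots> \<le> (\<Sum>x\<in>X. \<Sum>y\<in>X. \<epsilon> * (?n x * ?n y))"
    proof (intro sum_norm_le)
      fix x y assume "x \<in> X" "y \<in> X"
      then show "cmod (kernel_form M K (f x) (f y)
          - cnj (LINT z|M. f x z) * K x y * (LINT z|M. f y z)) \<le> \<epsilon> * (?n x * ?n y)"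
        using X supp by (intro kernel_form_near_constant near f) (auto simp: space_eq)
    qed
    also have "\<dots> = \<epsilon> * (\<Sum>x\<in>X. ?n x)\<^sup>2"
      by (simp only: power2_eq_square sum_product) (simp only: sum_distrib_left)
    finally show "cmod (kernel_form M K (\<lambda>y. \<Sum>x\<in>X. f x y) (\<lambda>y. \<Sum>x\<in>X. f x y)
        - quadratic_form K X (\<lambda>x. LINT z|M. f x z))
      \<le> \<epsilon> * (\<Sum>x\<in>X. ?n x)\<^sup>2" .
  qed (use \<open>d > 0\<close> in simp)
qed

text \<open>Cut \<open>f\<close> into pieces of small support by a continuous partition of unity \<open>w\<close>. The form of \<open>f\<close> is
  then close to the quadratic form of the kernel matrix at the vector of integrals of the pieces,
  and the error does not grow with the number of pieces, since their integral norms add up to that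
  of \<open>f\<close>.\<close>

lemma kernel_form_nonneg_of_point_values:
  assumes psd: "\<And>X v. finite X \<Longrightarrow> X \<subseteq> S \<Longrightarrow> quadratic_form K X v \<in> \<real>\<^sub>\<ge>\<^sub>0"
    and f: "integrable M f"
  shows "kernel_form M K f f \<in> \<real>\<^sub>\<ge>\<^sub>0"
proof (rule nonneg_Reals_limitI)
  fix \<epsilon> :: real
  assume "\<epsilon> > 0"
  then obtain \<delta> where "\<delta> > 0" and \<delta>: "\<forall>X f. localized_family \<delta> X f \<longrightarrow>
      cmod (kernel_form M K (\<lambda>y. \<Sum>x\<in>X. f x y) (\<lambda>y. \<Sum>x\<in>X. f x y)
        - quadratic_form K X (\<lambda>x. LINT z|M. f x z))
      \<le> \<epsilon> * (\<Sum>x\<in>X. LINT z|M. cmod (f x z))\<^sup>2"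
    using kernel_form_near_point_masses by meson
  obtain X where X: "finite X" "X \<subseteq> S" "S \<subseteq> (\<Union>x\<in>X. ball x \<delta>)"
    using seq_compact_imp_totally_bounded[OF compact_imp_seq_compact[OF compact_S],
        rule_format, OF \<open>\<delta> > 0\<close>]
    by (elim exE conjE)
  \<comment> \<open>Tents on the balls of a finite cover; normalising their sum gives the partition of unity.\<close>
  define p where "p x y = max 0 (\<delta> - dist y x)" for x y :: 'a
  define w where "w x y = p x y / (\<Sum>x\<in>X. p x y)" for x y :: 'a
  have p_nonneg: "p x y \<ge> 0" for x y
    by (simp add: p_def)
  have total: "(\<Sum>x\<in>X. p x y) > 0" if "y \<in> S" for y
  proof -
    obtain x where "x \<in> X" "p x y > 0"
      using X(3) \<open>y \<in> S\<close> by (auto simp: p_def dist_commute)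
    then show ?thesis
      using X(1) p_nonneg by (intro sum_pos2) auto
  qed
  have w_nonneg: "w x y \<ge> 0" for x y
    by (simp add: w_def p_nonneg sum_nonneg)
  have w_sum: "(\<Sum>x\<in>X. w x y) = 1" if "y \<in> S" for y
    using total[OF that] by (simp add: w_def flip: sum_divide_distrib)
  have w_le: "w x y \<le> 1" if "x \<in> X" "y \<in> S" for x y
    using member_le_sum[of x X "\<lambda>x. w x y"] X(1) w_nonneg w_sum that by simp
  have w_measurable: "w x \<in> borel_measurable M" for x
  proof (rule continuous_imp_borel_measurable)
    have "(\<Sum>x\<in>X. max 0 (\<delta> - dist y x)) \<noteq> 0" if "y \<in> S" for y
      using total[OF that] by (simp add: p_def)
    then show "continuous_on S (w x)"
      unfolding w_def p_def by (intro continuous_intros) auto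
  qed
  define g where "g x y = of_real (w x y) * f y" for x y
  have g: "integrable M (g x)" if "x \<in> X" for x
    using f
  proof (rule Bochner_Integration.integrable_bound)
    show "g x \<in> borel_measurable M"
      unfolding g_def using w_measurable[of x] borel_measurable_integrable[OF f] by measurable
    show "AE y in M. norm (g x y) \<le> norm (f y)"
      using w_nonneg w_le[OF that]
      by (intro AE_I2) (auto simp: g_def norm_mult space_eq intro!: mult_left_le_one_le)
  qed
  have supp: "dist y x < \<delta>" if "g x y \<noteq> 0" for x y
  proof -
    have "p x y \<noteq> 0"
      using that by (auto simp: g_def w_def)
    then show ?thesis
      by (simp add: p_def max_def split: if_splits)
  qed
  have "kernel_form M K (\<lambda>y. \<Sum>x\<in>X. g x y) (\<lambda>y. \<Sum>x\<in>X. g x y) = kernel_form M K f f"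
    unfolding kernel_form_def
    by (intro Bochner_Integration.integral_cong refl)
      (simp add: g_def space_eq w_sum flip: sum_distrib_right of_real_sum)
  moreover have "(\<Sum>x\<in>X. LINT y|M. cmod (g x y)) = (LINT y|M. cmod (f y))"
  proof -
    have "(\<Sum>x\<in>X. LINT y|M. cmod (g x y)) = (LINT y|M. (\<Sum>x\<in>X. cmod (g x y)))"
      using g by (intro Bochner_Integration.integral_sum[symmetric]) auto
    also have "\<dots> = (LINT y|M. cmod (f y))"
      by (intro Bochner_Integration.integral_cong refl)
        (simp add: g_def norm_mult w_nonneg space_eq w_sum flip: sum_distrib_right)
    finally show ?thesis .
  qed
  ultimately have "cmod (kernel_form M K f f
      - quadratic_form K X (\<lambda>x. LINT z|M. g x z))
      \<le> \<epsilon> * (LINT y|M. cmod (f y))\<^sup>2"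
    using \<delta>[rule_format, where X = X and f = g] X g supp by (simp add: localized_family_def)
  then show "\<exists>w\<in>\<real>\<^sub>\<ge>\<^sub>0. cmod (kernel_form M K f f - w) \<le> \<epsilon> * (LINT y|M. cmod (f y))\<^sup>2"
    using psd[OF X(1,2), of "\<lambda>x. LINT z|M. g x z"] by blast
qed

text \<open>Spread the mass \<open>v x\<close> evenly over a small ball around \<open>x\<close>, which is possible because balls have
  positive measure. The integral norm of the resulting function remains \<open>\<bar>v x\<bar>\<close> as the ball
  shrinks, and its form tends to the quadratic form of the kernel matrix.\<close>

lemma point_values_nonneg_of_kernel_form:
  assumes form: "\<And>f. f \<in> L2 M \<Longrightarrow> kernel_form M K f f \<in> \<real>\<^sub>\<ge>\<^sub>0"
    and full_support: "\<And>x r. x \<in> S \<Longrightarrow> r > 0 \<Longrightarrow> measure M (ball x r \<inter> S) > 0"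
    and X: "finite X" "X \<subseteq> S"
  shows "quadratic_form K X v \<in> \<real>\<^sub>\<ge>\<^sub>0"
proof (rule nonneg_Reals_limitI)
  fix \<epsilon> :: real
  assume "\<epsilon> > 0"
  then obtain \<delta> where "\<delta> > 0" and \<delta>: "\<forall>X f. localized_family \<delta> X f \<longrightarrow>
      cmod (kernel_form M K (\<lambda>y. \<Sum>x\<in>X. f x y) (\<lambda>y. \<Sum>x\<in>X. f x y)
        - quadratic_form K X (\<lambda>x. LINT z|M. f x z))
      \<le> \<epsilon> * (\<Sum>x\<in>X. LINT z|M. cmod (f x z))\<^sup>2"
    using kernel_form_near_point_masses by meson
  define B where "B x = ball x \<delta> \<inter> S" for x
  have B [measurable]: "B x \<in> sets M" for x
    unfolding B_def sets_eq sets_restrict_space by auto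
  have B_pos: "measure M (B x) > 0" if "x \<in> X" for x
    using full_support[of x \<delta>] that X \<open>\<delta> > 0\<close> by (auto simp: B_def)
  define b where "b x y = v x * of_real (indicator (B x) y / measure M (B x))" for x y
  have b_L2: "b x \<in> L2 M" for x
  proof -
    have "(\<lambda>y. (cmod (b x y))\<^sup>2)
        = (\<lambda>y. (cmod (v x) / measure M (B x))\<^sup>2 * indicator (B x) y)"
      by (auto simp: b_def fun_eq_iff norm_mult norm_divide indicator_def)
    moreover have "b x \<in> borel_measurable M"
      unfolding b_def by measurable
    moreover have "integrable M (indicator (B x) :: _ \<Rightarrow> real)"
      by (intro integrable_real_indicator B) (simp add: less_top[symmetric])
    ultimately show ?thesis
      by (simp add: L2_def)
  qed
  have b: "integrable M (b x)" for x
    by (rule L2_integrable[OF b_L2])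
  have supp: "dist y x < \<delta>" if "b x y \<noteq> 0" for x y
    using that by (auto simp: b_def B_def indicator_def dist_commute split: if_splits)
  have integral_b: "(LINT y|M. b x y) = v x" if "x \<in> X" for x
    using B_pos[OF that] by (simp add: b_def Int_absorb2 sets.sets_into_space[OF B])
  have norm_b: "(LINT y|M. cmod (b x y)) = cmod (v x)" if "x \<in> X" for x
  proof -
    have "(\<lambda>y. cmod (b x y)) = (\<lambda>y. cmod (v x) / measure M (B x) * indicator (B x) y)"
      by (auto simp: b_def fun_eq_iff norm_mult norm_divide indicator_def)
    then show ?thesis
      using B_pos[OF that] by (simp add: Int_absorb2 sets.sets_into_space[OF B])
  qed
  have "cmod (quadratic_form K X v - kernel_form M K (\<lambda>y. \<Sum>x\<in>X. b x y) (\<lambda>y. \<Sum>x\<in>X. b x y))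
      \<le> \<epsilon> * (\<Sum>x\<in>X. cmod (v x))\<^sup>2"
    using \<delta>[rule_format, where X = X and f = b] X b supp
    by (simp add: localized_family_def integral_b norm_b norm_minus_commute)
  moreover have "kernel_form M K (\<lambda>y. \<Sum>x\<in>X. b x y) (\<lambda>y. \<Sum>x\<in>X. b x y) \<in> \<real>\<^sub>\<ge>\<^sub>0"
    by (intro form L2_sum b_L2)
  ultimately show "\<exists>w\<in>\<real>\<^sub>\<ge>\<^sub>0. cmod (quadratic_form K X v - w)
      \<le> \<epsilon> * (\<Sum>x\<in>X. cmod (v x))\<^sup>2"
    by (rule bexI)
qed

text \<open>The form is continuous for the integral norm, hence for the square norm, and its nonnegative
  values on a dense subspace pass to the limit.\<close>

lemma kernel_form_nonneg_of_dense_span: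
  assumes F: "\<And>l. l \<ge> 1 \<Longrightarrow> F l \<in> L2 M"
    and dense: "\<And>f \<epsilon>. f \<in> L2 M \<Longrightarrow> \<epsilon> > 0 \<Longrightarrow> \<exists>n c. L2_norm M (\<lambda>x. f x - (\<Sum>l=1..n. c l * F l x)) < \<epsilon>"
    and span: "\<And>n c. kernel_form M K (\<lambda>x. \<Sum>l=1..n. c l * F l x) (\<lambda>x. \<Sum>l=1..n. c l * F l x) \<in> \<real>\<^sub>\<ge>\<^sub>0"
    and f: "f \<in> L2 M"
  shows "kernel_form M K f f \<in> \<real>\<^sub>\<ge>\<^sub>0"
proof -
  obtain C where "bounded_kernel M K C"
    using exists_bounded_kernel by blast
  then interpret bounded_kernel M K C .
  define m where "m = 1 + measure M (space M)"
  define a where "a = (LINT x|M. cmod (f x))"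
  have m: "m > 0"
    by (simp add: m_def add_pos_nonneg)
  have a: "a \<ge> 0"
    by (simp add: a_def)
  show ?thesis
  proof (rule nonneg_Reals_limitI)
    fix \<epsilon> :: real
    assume "\<epsilon> > 0"
    \<comment> \<open>The cut-off at 1 turns the quadratic term in the perturbation estimate into a linear one.\<close>
    define t where "t = min \<epsilon> 1"
    have t: "t > 0" "t \<le> \<epsilon>" "t \<le> 1"
      using \<open>\<epsilon> > 0\<close> by (auto simp: t_def)
    obtain n c where close: "L2_norm M (\<lambda>x. f x - (\<Sum>l=1..n. c l * F l x)) < t"
      using dense[OF f t(1)] by blast
    define g where "g x = (\<Sum>l=1..n. c l * F l x)" for x
    define \<eta> where "\<eta> = (LINT x|M. cmod (f x - g x))"
    have g: "g \<in> L2 M"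
      unfolding g_def by (intro L2_sum L2_cmult F) auto
    have \<eta>: "0 \<le> \<eta>" "\<eta> \<le> t * m"
      using L1_norm_le_of_L2_norm_less[OF L2_diff[OF f g], of t] close
      by (auto simp: \<eta>_def g_def m_def)
    have "cmod (kernel_form M K f f - kernel_form M K g g) \<le> C * (\<eta> * (2 * a + \<eta>))"
      using kernel_form_perturb[OF L2_integrable[OF f] L2_integrable[OF g]]
      by (simp add: \<eta>_def a_def)
    also have "\<dots> \<le> \<bar>C\<bar> * (\<eta> * (2 * a + \<eta>))"
      using \<eta> a by (intro mult_right_mono) auto
    also have "\<dots> \<le> \<bar>C\<bar> * ((\<epsilon> * m) * (2 * a + m))"
    proof (intro mult_left_mono mult_mono add_left_mono)
      show "\<eta> \<le> \<epsilon> * m"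
        using \<eta> t m by (meson less_imp_le mult_right_mono order_trans)
      have "t * m \<le> 1 * m"
        using t m by (intro mult_right_mono) auto
      then show "\<eta> \<le> m"
        using \<eta> by simp
    qed (use \<eta> a m \<open>\<epsilon> > 0\<close> in auto)
    finally have "cmod (kernel_form M K f f - kernel_form M K g g) \<le> \<epsilon> * (\<bar>C\<bar> * m * (2 * a + m))"
      by (simp add: mult_ac)
    moreover have "kernel_form M K g g \<in> \<real>\<^sub>\<ge>\<^sub>0"
      unfolding g_def by (rule span)
    ultimately show "\<exists>w\<in>\<real>\<^sub>\<ge>\<^sub>0. cmod (kernel_form M K f f - w) \<le> \<epsilon> * (\<bar>C\<bar> * m * (2 * a + m))"
      by blast
  qed
qed

text \<open>The operator acts by the transpose \<open>b\<close> of the coefficient matrix, and its finite section at \<open>v\<close> is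
  the value of the kernel form at the combination of the \<open>F l\<close> with the conjugate coefficients. So
  positivity of the operator means nonnegativity of the form on the span of the basis, and the
  preceding lemmas relate this to the values of the kernel at points.\<close>

lemma positive_coefficient_operator_iff:
  assumes hermitian: "\<And>x y. x \<in> S \<Longrightarrow> y \<in> S \<Longrightarrow> K x y = cnj (K y x)"
    and full_support: "\<And>x r. x \<in> S \<Longrightarrow> r > 0 \<Longrightarrow> measure M (ball x r \<inter> S) > 0"
    and basis: "L2_orthonormal_basis M F"
  shows "positive_operator {1..} (coeff_operator (\<lambda>l m. kernel_form M K (F l) (F m))) \<longleftrightarrow>
    (\<forall>X v. finite X \<longrightarrow> X \<subseteq> S \<longrightarrow> quadratic_form K X v \<in> \<real>\<^sub>\<ge>\<^sub>0)"
    (is "?pos \<longleftrightarrow> ?psd")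
proof -
  obtain C where "bounded_kernel M K C"
    using exists_bounded_kernel by blast
  then interpret bounded_kernel M K C .
  have F: "F l \<in> L2 M" if "l \<ge> 1" for l
    using basis that by (simp add: L2_orthonormal_basis_def)
  have F_int: "integrable M (F l)" if "l \<ge> 1" for l
    using L2_integrable[OF F[OF that]] .
  have dense: "\<exists>n c. L2_norm M (\<lambda>x. f x - (\<Sum>l=1..n. c l * F l x)) < \<epsilon>" if "f \<in> L2 M" "\<epsilon> > 0" for f \<epsilon>
    using basis that by (simp add: L2_orthonormal_basis_def)
  define b where "b l m = kernel_form M K (F m) (F l)" for l m
  have "(\<lambda>(l, m). (cmod (kernel_form M K (F l) (F m)))\<^sup>2) summable_on {1..} \<times> {1..}"
    using basis by (intro kernel_coefficients_square_summable) (auto simp: L2_orthonormal_basis_def)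
  then have square_summable: "(\<lambda>(l, m). (cmod (b l m))\<^sup>2) summable_on {1..} \<times> {1..}"
    by (subst summable_on_swap) (simp add: b_def)
  have b_hermitian: "b l m = cnj (b m l)" if "l \<in> {1..}" "m \<in> {1..}" for l m
    unfolding b_def
    by (intro kernel_form_hermitian F_int hermitian) (use that in \<open>auto simp: space_eq\<close>)
  have section_form: "quadratic_form b J v
      = kernel_form M K (\<lambda>x. \<Sum>l\<in>J. cnj (v l) * F l x) (\<lambda>x. \<Sum>l\<in>J. cnj (v l) * F l x)"
    if "J \<subseteq> {1..}" for J v
  proof -
    have "kernel_form M K (\<lambda>x. \<Sum>l\<in>J. cnj (v l) * F l x) (\<lambda>x. \<Sum>l\<in>J. cnj (v l) * F l x)
        = (\<Sum>m\<in>J. \<Sum>l\<in>J. kernel_form M K (\<lambda>x. cnj (v m) * F m x) (\<lambda>x. cnj (v l) * F l x))"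
      using that F_int by (intro kernel_form_sum) auto
    also have "\<dots> = (\<Sum>m\<in>J. \<Sum>l\<in>J. cnj (v l) * b l m * v m)"
      by (simp add: kernel_form_cmult b_def mult_ac)
    also have "\<dots> = quadratic_form b J v"
      by (rule sum.swap)
    finally show ?thesis ..
  qed
  have "coeff_operator (\<lambda>l m. kernel_form M K (F l) (F m)) = matrix_operator {1..} b"
    by (simp add: coeff_operator_def matrix_operator_def b_def fun_eq_iff)
  then have "?pos \<longleftrightarrow> (\<forall>J v. finite J \<longrightarrow> J \<subseteq> {1..} \<longrightarrow>
      quadratic_form b J v \<in> \<real>\<^sub>\<ge>\<^sub>0)" (is "_ \<longleftrightarrow> ?sections")
    using positive_operator_iff_finite_sections[OF square_summable b_hermitian] by simp
  also have "\<dots> \<longleftrightarrow> ?psd"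
  proof
    assume sections: ?sections
    have "kernel_form M K (\<lambda>x. \<Sum>l=1..n. c l * F l x) (\<lambda>x. \<Sum>l=1..n. c l * F l x) \<in> \<real>\<^sub>\<ge>\<^sub>0" for n c
      using sections[rule_format, of "{1..n}" "\<lambda>l. cnj (c l)"]
        section_form[of "{1..n}" "\<lambda>l. cnj (c l)"] by simp
    from kernel_form_nonneg_of_dense_span[OF F dense this] show ?psd
      using point_values_nonneg_of_kernel_form[OF _ full_support] by blast
  next
    assume psd: ?psd
    show ?sections
    proof (intro allI impI)
      fix J :: "nat set" and v :: "nat \<Rightarrow> complex"
      assume J: "finite J" "J \<subseteq> {1..}"
      have "integrable M (\<lambda>x. \<Sum>l\<in>J. cnj (v l) * F l x)"
        using J by (intro Bochner_Integration.integrable_sum integrable_mult_right F_int) auto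
      then show "quadratic_form b J v \<in> \<real>\<^sub>\<ge>\<^sub>0"
        unfolding section_form[OF J(2)]
        using psd by (intro kernel_form_nonneg_of_point_values) auto
    qed
  qed
  finally show ?thesis .
qed

end


section \<open>The surface measure of the sphere\<close>

lemma spherical_coord_on_sphere: "spherical_coord p \<in> S2"
proof -
  have "sin a ^ 2 * cos b ^ 2 + sin a ^ 2 * sin b ^ 2 + cos a ^ 2 = 1" for a b :: real
    by (simp flip: distrib_left)
  then show ?thesis
    by (simp add: spherical_coord_def case_prod_unfold norm_eq_1 inner_vec_def sum_3 vector_3
        power_mult_distrib flip: power2_eq_square)
qed

text \<open>The polar angle is determined by the third coordinate. At the poles the sine vanishes and the
  azimuth is arbitrary.\<close>

lemma spherical_coord_surj:
  assumes "\<xi> \<in> S2"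
  obtains \<theta> \<phi> where "\<theta> \<in> {0..pi}" "\<phi> \<in> {0..2 * pi}" "spherical_coord (\<theta>, \<phi>) = \<xi>"
proof -
  have norm: "(\<xi> $ 1)\<^sup>2 + (\<xi> $ 2)\<^sup>2 + (\<xi> $ 3)\<^sup>2 = 1"
    using assms by (simp add: norm_eq_1 inner_vec_def sum_3 power2_eq_square)
  define \<theta> where "\<theta> = arccos (\<xi> $ 3)"
  have "(\<xi> $ 3)\<^sup>2 \<le> 1"
    using norm zero_le_power2[of "\<xi> $ 1"] zero_le_power2[of "\<xi> $ 2"] by linarith
  then have z: "- 1 \<le> \<xi> $ 3" "\<xi> $ 3 \<le> 1"
    by (auto simp: abs_square_le_1)
  then have \<theta>: "\<theta> \<in> {0..pi}" "cos \<theta> = \<xi> $ 3"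
    by (auto simp: \<theta>_def arccos_lbound arccos_ubound)
  have sin: "(sin \<theta>)\<^sup>2 = (\<xi> $ 1)\<^sup>2 + (\<xi> $ 2)\<^sup>2"
    using norm \<theta>(2) sin_cos_squared_add[of \<theta>] by simp
  obtain \<phi> where \<phi>: "\<phi> \<in> {0..2 * pi}" "\<xi> $ 1 = sin \<theta> * cos \<phi>" "\<xi> $ 2 = sin \<theta> * sin \<phi>"
  proof (cases "sin \<theta> = 0")
    case True
    then have "\<xi> $ 1 = 0" "\<xi> $ 2 = 0"
      using sin by (auto simp: sum_power2_eq_zero_iff)
    with True show thesis
      by (intro that[of 0]) auto
  next
    case False
    have "(\<xi> $ 1 / sin \<theta>)\<^sup>2 + (\<xi> $ 2 / sin \<theta>)\<^sup>2 = (sin \<theta>)\<^sup>2 / (sin \<theta>)\<^sup>2"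
      by (simp only: sin power_divide add_divide_distrib)
    also have "\<dots> = 1"
      using False by simp
    finally have "(\<xi> $ 1 / sin \<theta>)\<^sup>2 + (\<xi> $ 2 / sin \<theta>)\<^sup>2 = 1" .
    then obtain \<phi> where "0 \<le> \<phi>" "\<phi> < 2 * pi" "\<xi> $ 1 / sin \<theta> = cos \<phi>" "\<xi> $ 2 / sin \<theta> = sin \<phi>"
      by (rule sincos_total_2pi)
    with False show thesis
      by (intro that[of \<phi>]) (auto simp: field_simps)
  qed
  have "spherical_coord (\<theta>, \<phi>) = \<xi>"
    using \<phi> \<theta> by (simp add: spherical_coord_def vec_eq_iff forall_3 vector_3)
  with \<theta> \<phi> show thesis
    by (intro that)
qed

lemma continuous_on_spherical_coord: "continuous_on UNIV spherical_coord"
proof -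
  have "continuous_on UNIV (\<lambda>p. spherical_coord p $ 1)"
    and "continuous_on UNIV (\<lambda>p. spherical_coord p $ 2)"
    and "continuous_on UNIV (\<lambda>p. spherical_coord p $ 3)"
    unfolding spherical_coord_def case_prod_unfold vector_3 by (intro continuous_intros)+
  then have "continuous_on UNIV (\<lambda>p. spherical_coord p $ i)" for i
    using exhaust_3[of i] by auto
  then have "continuous_on UNIV (\<lambda>p. \<chi> i. spherical_coord p $ i)"
    by (rule continuous_on_vec_lambda)
  then show ?thesis
    by simp
qed

lemma spherical_coord_measurable: "spherical_coord \<in> measurable borel (restrict_space borel S2)"
  using continuous_on_spherical_coord spherical_coord_on_sphere
  by (intro measurable_restrict_space2 borel_measurable_continuous_onI) auto

text \<open>The density in the definition of the surface measure, named so that it can be kept folded.\<close>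

definition spherical_density :: "real \<times> real \<Rightarrow> ennreal" where
  "spherical_density = (\<lambda>(\<theta>, \<phi>). ennreal (sin \<theta> * indicator ({0..pi} \<times> {0..2 * pi}) (\<theta>, \<phi>)))"

lemma spherical_density_measurable [measurable]: "spherical_density \<in> borel_measurable borel"
proof -
  have "(\<lambda>p. sin (fst p) * indicator ({0..pi} \<times> {0..2 * pi}) p) \<in> borel_measurable (borel :: (real \<times> real) measure)"
    by (intro borel_measurable_times borel_measurable_indicator borel_measurable_continuous_onI
        continuous_intros borel_closed closed_Times)
  then show ?thesis
    by (simp add: spherical_density_def case_prod_unfold)
qed

lemma sphere_measure_eq:
  "sphere_measure = distr (density lborel spherical_density) (restrict_space borel S2) spherical_coord"
  by (simp add: sphere_measure_def spherical_density_def)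

lemma space_sphere_measure: "space sphere_measure = S2"
  by (simp add: sphere_measure_eq space_restrict_space)

lemma sets_sphere_measure: "sets sphere_measure = sets (restrict_space borel S2)"
  by (simp add: sphere_measure_eq)

lemma emeasure_sphere_measure:
  assumes "A \<in> sets (restrict_space borel S2)"
  shows "emeasure sphere_measure A = (\<integral>\<^sup>+p. spherical_density p * indicator (spherical_coord -` A) p \<partial>lborel)"
proof -
  have "spherical_coord \<in> measurable (density lborel spherical_density) (restrict_space borel S2)"
    using spherical_coord_measurable by simp
  moreover have "spherical_coord -` A \<in> sets borel"
    using measurable_sets[OF spherical_coord_measurable assms] by simp
  ultimately show ?thesis
    using assms by (simp add: sphere_measure_eq emeasure_distr emeasure_density)
qed

text \<open>The density is at most 1 and lives on a bounded rectangle.\<close>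

lemma finite_measure_sphere_measure: "finite_measure sphere_measure"
proof
  have "spherical_density p \<le> indicator ({0..pi} \<times> {0..2 * pi}) p" for p
    by (cases p) (auto simp: spherical_density_def indicator_def intro: ennreal_leI)
  then have le: "spherical_density p * indicator X p \<le> indicator ({0..pi} \<times> {0..2 * pi}) p" for p X
    by (rule order_trans[rotated]) (simp add: indicator_def)
  have "S2 \<in> sets (restrict_space borel S2)"
    using sets.top[of "restrict_space borel S2"] by (simp add: space_restrict_space)
  then have "emeasure sphere_measure S2 \<le> (\<integral>\<^sup>+p. indicator ({0..pi} \<times> {0..2 * pi}) p \<partial>lborel)"
    unfolding emeasure_sphere_measure[OF \<open>S2 \<in> _\<close>] by (intro nn_integral_mono le)
  also have "\<dots> = emeasure lborel ({0..pi} \<times> {0..2 * pi})"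
    by (intro nn_integral_indicator) (simp add: borel_closed closed_Times)
  also have "\<dots> < \<infinity>"
    by (intro emeasure_bounded_finite bounded_Times) auto
  finally show "emeasure sphere_measure (space sphere_measure) \<noteq> \<infinity>"
    by (simp add: space_sphere_measure)
qed

text \<open>The preimage of the ball under the parametrisation is open and contains a point of the closed
  parameter rectangle, so it meets the open rectangle in a nonempty open set \<open>U\<close>. This has
  positive Lebesgue measure, and the density is positive on it.\<close>

lemma sphere_measure_full_support:
  assumes \<xi>: "\<xi> \<in> S2" and r: "r > 0"
  shows "measure sphere_measure (ball \<xi> r \<inter> S2) > 0"
proof -
  interpret finite_measure sphere_measure
    by (rule finite_measure_sphere_measure)
  let ?box = "{0<..<pi} \<times> {0<..<2 * pi} :: (real \<times> real) set"
  define U where "U = spherical_coord -` ball \<xi> r \<inter> ?box"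
  obtain \<theta> \<phi> where p: "\<theta> \<in> {0..pi}" "\<phi> \<in> {0..2 * pi}" "spherical_coord (\<theta>, \<phi>) = \<xi>"
    using \<xi> by (rule spherical_coord_surj)
  have open_preimage: "open (spherical_coord -` ball \<xi> r)"
    using continuous_on_spherical_coord by (simp add: open_vimage)
  have "(\<theta>, \<phi>) \<in> closure ?box"
    using p by (simp add: closure_Times closure_greaterThanLessThan)
  moreover have "(\<theta>, \<phi>) \<in> spherical_coord -` ball \<xi> r"
    using p r by simp
  ultimately have "U \<noteq> {}"
    using open_preimage unfolding U_def closure_iff_nhds_not_empty by blast
  moreover have "open U"
    unfolding U_def by (intro open_Int open_preimage open_Times) auto
  ultimately have "\<not> negligible U"
    using open_not_negligible by blast
  have A: "ball \<xi> r \<inter> S2 \<in> sets (restrict_space borel S2)"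
    by (auto simp: sets_restrict_space)
  have "emeasure sphere_measure (ball \<xi> r \<inter> S2) \<noteq> 0"
  proof
    assume "emeasure sphere_measure (ball \<xi> r \<inter> S2) = 0"
    then have "AE p in lborel. spherical_density p * indicator (spherical_coord -` (ball \<xi> r \<inter> S2)) p = 0"
      using measurable_sets[OF spherical_coord_measurable A]
      by (simp add: emeasure_sphere_measure[OF A] nn_integral_0_iff_AE)
    then have "AE p in lborel. p \<notin> U"
    proof (eventually_elim)
      case (elim p)
      show ?case
      proof
        assume "p \<in> U"
        then have "spherical_density p > 0" "p \<in> spherical_coord -` (ball \<xi> r \<inter> S2)"
          using spherical_coord_on_sphere[of p]
          by (cases p; auto simp: U_def spherical_density_def sin_gt_zero)+
        with elim show False
          by simp
      qed
    qed
    then have "U \<in> null_sets lborel"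
      using \<open>open U\<close> by (subst (asm) AE_iff_null_sets[symmetric]) auto
    then have "negligible U"
      by (simp add: negligible_iff_null_sets null_sets_completionI)
    with \<open>\<not> negligible U\<close> show False ..
  qed
  then show ?thesis
    by (simp add: emeasure_eq_measure zero_less_measure_iff)
qed

section \<open>Positive definite kernels and positive operators\<close>

theorem theorem1:
  fixes K :: "real ^ 3 \<Rightarrow> real ^ 3 \<Rightarrow> complex"
    and F :: "nat \<Rightarrow> real ^ 3 \<Rightarrow> complex"
  assumes "continuous_on (S2 \<times> S2) (\<lambda>(\<xi>, \<zeta>). K \<xi> \<zeta>)"
    and "\<And>\<xi> \<zeta>. \<xi> \<in> S2 \<Longrightarrow> \<zeta> \<in> S2 \<Longrightarrow> K \<xi> \<zeta> = cnj (K \<zeta> \<xi>)"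
    and "L2_orthonormal_basis sphere_measure F"
    and "\<And>l. l \<ge> 1 \<Longrightarrow> laplace_beltrami_eigenfunction (F l)"
  shows "positive_definite_on S2 K \<longleftrightarrow>
         positive_operator {1..} (coeff_operator (kernel_coeff K F))"
proof -
  interpret finite_measure sphere_measure
    by (rule finite_measure_sphere_measure)
  interpret continuous_kernel sphere_measure S2 K
    by unfold_locales (rule space_sphere_measure sets_sphere_measure compact_sphere assms(1))+
  have "kernel_coeff K F = (\<lambda>l m. kernel_form sphere_measure K (F l) (F m))"
    by (intro ext) (simp add: kernel_coeff_def kernel_form_def)
  then have "positive_operator {1..} (coeff_operator (kernel_coeff K F)) \<longleftrightarrow>
      (\<forall>X v. finite X \<longrightarrow> X \<subseteq> S2 \<longrightarrow> quadratic_form K X v \<in> \<real>\<^sub>\<ge>\<^sub>0)"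
    using positive_coefficient_operator_iff[OF assms(2) sphere_measure_full_support assms(3)]
    by (simp only:)
  moreover have "positive_definite_on S2 K \<longleftrightarrow>
      (\<forall>X v. finite X \<longrightarrow> X \<subseteq> S2 \<longrightarrow> quadratic_form K X v \<in> \<real>\<^sub>\<ge>\<^sub>0)"
    using assms(2) by (rule positive_definite_on_iff)
  ultimately show ?thesis
    by (simp only:)
qed

end
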